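(* For $i=1,2$, let $\Lambda_i$ be a finite $k_i$-graph with a $\Lambda_i$-semibranching function system $\{\tau^i_\lambda:\lambda\in\Lambda_i\}$ on $(X_i,\mu_i)$, with coding maps $\tau^{i,e_j}$ for $1\le j\le k_i$. For an edge $\lambda\in\Lambda_1$ let $\{\lambda^1_v:v\in\Lambda_2^0\}$ denote the corresponding edges $\lambda^1_v=(\lambda,v)$ in $\Lambda_1\times\Lambda_2$, with $s(\lambda^1_v)=(s(\lambda),v)$ and $r(\lambda^1_v)=(r(\lambda),v)$; similarly, for an edge $\eta\in\Lambda_2$ let $\{\eta^2_w:w\in\Lambda_1^0\}$ denote the corresponding edges $\eta^2_w=(w,\eta)$, with $s(\eta^2_w)=(w,s(\eta))$ and $r(\eta^2_w)=(w,r(\eta))$. For $w\in\Lambda_1^0$, $v\in\Lambda_2^0$ define $$D_{w,v}:=D_w\times D_v\subseteq X_1\times X_2.$$ Define prefixing maps on $X_1\times X_2$ (equipped with the product measure $\mu_1\times\mu_2$) by $$\tau_{\lambda^1_v}(x,y):=(\tau^1_\lambda(x),y)\ \text{ on the domain } D_{s(\lambda),v}, \qquad \tau_{\eta^2_w}(x,y):=(x,\tau^2_\eta(y))\ \text{ on the domain } D_{w,s(\eta)},$$ and coding maps by $\tau^{e_j}(x,y)=(\tau^{1,e_j}(x),y)$ if $1\le j\le k_1$ and $\tau^{e_j}(x,y)=(x,\tau^{2,e_{j-k_1}}(y))$ if $k_1<j\le k_1+k_2$. Then the prefixing maps $\{\tau_{\lambda^1_v},\tau_{\eta^2_w}: v\in\Lambda_2^0,\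 w\in\Lambda_1^0,\ |d(\lambda)|=|d(\eta)|=1\}$ and coding maps $\{\tau^{e_j}\}$ satisfy the following conditions (i)-(v) for $\Lambda:=\Lambda_1\times\Lambda_2$, $k:=k_1+k_2$, $X:=X_1\times X_2$, $\mu:=\mu_1\times\mu_2$ (where $D_f$ and $R_f$ denote the domain and range of $\tau_f$ for an edge $f\in\Lambda$), and thus give rise to a $\Lambda_1\times\Lambda_2$-semibranching function system on $X_1\times X_2$ (the prefixing map of a path being the composition of the prefixing maps of the edges in a factorization of it, and $\tau^m=(\tau^{e_1})^{m_1}\circ\cdots\circ(\tau^{e_k})^{m_k}$): (i) for any edges $f,g$ of $\Lambda$ with $s(f)=s(g)=u$, $D_f=D_g=:D_u$, and $\mu(D_u)>0$ for all $u\in\Lambda^0$; (ii) $\mu(D_u\cap D_{u'})=0$ for $u\neq u'\in\Lambda^0$; (iii) if $f\alpha=g\beta$ for $f,\beta\in\Lambda^{e_i}$ and $g,\alpha\in\Lambda^{e_j}$, then $R_\alpha\subset D_f$, $R_\beta\subset D_g$ and $\tau_f\circ\tau_\alpha=\tau_g\circ\tau_\beta$; (iv) $\tau^{e_i}\circ\tau^{e_j}=\tau^{e_j}\circ\tau^{e_i}$ for all $1\le i,j\le k$; (v) $\mu(D_u\setminus\bigcup_{g\in u\Lambda^{e_i}}R_g)=0$ for $u\in\Lambda^0$, $1\le i\le k$.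
   Context: $\mathbb N=\{0,1,2,\dots\}$, $e_1,\dots,e_k$ the standard basis of $\mathbb N^k$. A $k$-graph is a countable small category $\Lambda$ with a degree functor $d:\Lambda\to\mathbb N^k$ satisfying the factorization property: if $d(\lambda)=m+n$ then there are unique $\mu,\nu$ with $\lambda=\mu\nu$, $d(\mu)=m$, $d(\nu)=n$. $\Lambda^n=d^{-1}(n)$; $\Lambda^0$ is the set of objects (vertices, identified with identity morphisms); edges are elements of degree $e_i$ for some $i$, i.e. $|d(\lambda)|=1$; $r,s$ are range and source; $v\Lambda^n=\{\lambda\in\Lambda^n:r(\lambda)=v\}$; $s(\lambda)\Lambda=\{\nu:r(\nu)=s(\lambda)\}$. $\Lambda$ is finite if every $\Lambda^n$ is finite. The product graph $\Lambda_1\times\Lambda_2$ of a $k_1$-graph and a $k_2$-graph is the product category with degree map $(\lambda_1,\lambda_2)\mapsto(d(\lambda_1),d(\lambda_2))\in\mathbb N^{k_1}\times\mathbb N^{k_2}=\mathbb N^{k_1+k_2}$; it is a $(k_1+k_2)$-graph. Semibranching function system: given $(X,\mu)$ and finitely many measurable maps $\sigma_i:D_i\to X$, $D_i\subset X$ measurable, the family is a semibranching function system if (a) with $R_i=\sigma_i(D_i)$, $\mu(X\setminus\bigcup_iR_i)=0$ and $\mu(R_i\cap R_j)=0$ for $i\ne j$; (b) $\Phi_{\sigma_i}=\frac{d(\mu\circ\sigma_i)}{d\mu}>0$ $\mu$-a.e. on $D_i$ (with $(\mu\circ\sigma_i)(E)=\mu(\sigma_i(E))$). A measurable $\sigma:X\to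 X$ is a coding map if $\sigma\circ\sigma_i(x)=x$ for all $x\in D_i$. $\Lambda$-semibranching function system (finite $k$-graph $\Lambda$) on $(X,\mu)$: measurable subsets $\{D_\lambda\}_{\lambda\in\Lambda}$, prefixing maps $\{\tau_\lambda:D_\lambda\to X\}$ and coding maps $\{\tau^m:X\to X\}_{m\in\mathbb N^k}$ such that: (a) for each $m$, $\{\tau_\lambda:d(\lambda)=m\}$ is a semibranching function system with coding map $\tau^m$; (b) for $v\in\Lambda^0$, $\tau_v=\mathrm{id}$ and $\mu(D_v)>0$; (c) with $R_\lambda=\tau_\lambda(D_\lambda)$, for $\nu\in s(\lambda)\Lambda$ we have $R_\nu\subseteq D_\lambda$ up to a null set and $\tau_\lambda\tau_\nu=\tau_{\lambda\nu}$ a.e. (so $D_\lambda=D_{s(\lambda)}$ up to null sets); (d) $\tau^m\circ\tau^n=\tau^{m+n}$. Equalities and inclusions between the sets $D_\lambda,R_\lambda$, and domains and equalities of compositions of prefixing maps, are understood up to null sets. *)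

theory Defs
  imports "HOL-Analysis.Analysis"
begin

section \<open>Higher-rank graphs\<close>

text \<open>
  Elements of \<open>\<nat>\<^sup>k\<close> are functions \<open>nat \<Rightarrow> nat\<close> vanishing outside \<open>{..<k}\<close>, and coordinates are
  numbered from 0: the standard basis of \<open>\<nat>\<^sup>k\<close> is \<open>unit_deg 0, \<dots>, unit_deg (k - 1)\<close>.
\<close>

definition degrees :: "nat \<Rightarrow> (nat \<Rightarrow> nat) set" where
  "degrees k = {m. \<forall>i\<ge>k. m i = 0}"

definition zero_deg :: "nat \<Rightarrow> nat" where
  "zero_deg = (\<lambda>i. 0)"

definition add_deg :: "(nat \<Rightarrow> nat) \<Rightarrow> (nat \<Rightarrow> nat) \<Rightarrow> (nat \<Rightarrow> nat)" where
  "add_deg m n = (\<lambda>i. m i + n i)"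

definition unit_deg :: "nat \<Rightarrow> (nat \<Rightarrow> nat)" where
  "unit_deg i = (\<lambda>j. if j = i then 1 else 0)"

text \<open>
  A small category in arrows-only form: objects are identified with their identity morphisms, so
  range and source take values in the set of morphisms. The product \<open>cmp \<Lambda> \<mu> \<nu>\<close> is meaningful
  when \<open>src \<Lambda> \<mu> = rng \<Lambda> \<nu>\<close>.
\<close>

record 'a kgraph =
  mor :: "'a set"
  rng :: "'a \<Rightarrow> 'a"
  src :: "'a \<Rightarrow> 'a"
  cmp :: "'a \<Rightarrow> 'a \<Rightarrow> 'a"
  deg :: "'a \<Rightarrow> (nat \<Rightarrow> nat)"

definition paths :: "'a kgraph \<Rightarrow> (nat \<Rightarrow> nat) \<Rightarrow> 'a set" where
  "paths \<Lambda> m = {\<kappa> \<in> mor \<Lambda>. deg \<Lambda> \<kappa> = m}"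

definition verts :: "'a kgraph \<Rightarrow> 'a set" where
  "verts \<Lambda> = paths \<Lambda> zero_deg"

definition edges :: "'a kgraph \<Rightarrow> 'a set" where
  "edges \<Lambda> = (\<Union>i. paths \<Lambda> (unit_deg i))"

locale k_graph =
  fixes k :: nat and \<Lambda> :: "'a kgraph"
  assumes countable_mor: "countable (mor \<Lambda>)"
    and rng_mor: "\<kappa> \<in> mor \<Lambda> \<Longrightarrow> rng \<Lambda> \<kappa> \<in> mor \<Lambda>"
    and src_mor: "\<kappa> \<in> mor \<Lambda> \<Longrightarrow> src \<Lambda> \<kappa> \<in> mor \<Lambda>"
    and rng_ident: "\<kappa> \<in> mor \<Lambda> \<Longrightarrow> rng \<Lambda> (rng \<Lambda> \<kappa>) = rng \<Lambda> \<kappa> \<and> src \<Lambda> (rng \<Lambda> \<kappa>) = rng \<Lambda> \<kappa>"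
    and src_ident: "\<kappa> \<in> mor \<Lambda> \<Longrightarrow> rng \<Lambda> (src \<Lambda> \<kappa>) = src \<Lambda> \<kappa> \<and> src \<Lambda> (src \<Lambda> \<kappa>) = src \<Lambda> \<kappa>"
    and comp_mor: "\<lbrakk>\<mu> \<in> mor \<Lambda>; \<nu> \<in> mor \<Lambda>; src \<Lambda> \<mu> = rng \<Lambda> \<nu>\<rbrakk> \<Longrightarrow> cmp \<Lambda> \<mu> \<nu> \<in> mor \<Lambda>"
    and rng_comp: "\<lbrakk>\<mu> \<in> mor \<Lambda>; \<nu> \<in> mor \<Lambda>; src \<Lambda> \<mu> = rng \<Lambda> \<nu>\<rbrakk> \<Longrightarrow> rng \<Lambda> (cmp \<Lambda> \<mu> \<nu>) = rng \<Lambda> \<mu>"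
    and src_comp: "\<lbrakk>\<mu> \<in> mor \<Lambda>; \<nu> \<in> mor \<Lambda>; src \<Lambda> \<mu> = rng \<Lambda> \<nu>\<rbrakk> \<Longrightarrow> src \<Lambda> (cmp \<Lambda> \<mu> \<nu>) = src \<Lambda> \<nu>"
    and comp_assoc: "\<lbrakk>\<kappa> \<in> mor \<Lambda>; \<mu> \<in> mor \<Lambda>; \<nu> \<in> mor \<Lambda>; src \<Lambda> \<kappa> = rng \<Lambda> \<mu>; src \<Lambda> \<mu> = rng \<Lambda> \<nu>\<rbrakk>
          \<Longrightarrow> cmp \<Lambda> (cmp \<Lambda> \<kappa> \<mu>) \<nu> = cmp \<Lambda> \<kappa> (cmp \<Lambda> \<mu> \<nu>)"
    and comp_rng: "\<kappa> \<in> mor \<Lambda> \<Longrightarrow> cmp \<Lambda> (rng \<Lambda> \<kappa>) \<kappa> = \<kappa>"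
    and comp_src: "\<kappa> \<in> mor \<Lambda> \<Longrightarrow> cmp \<Lambda> \<kappa> (src \<Lambda> \<kappa>) = \<kappa>"
    and deg_degrees: "\<kappa> \<in> mor \<Lambda> \<Longrightarrow> deg \<Lambda> \<kappa> \<in> degrees k"
    and deg_ident: "\<kappa> \<in> mor \<Lambda> \<Longrightarrow> deg \<Lambda> (rng \<Lambda> \<kappa>) = zero_deg \<and> deg \<Lambda> (src \<Lambda> \<kappa>) = zero_deg"
    and deg_comp: "\<lbrakk>\<mu> \<in> mor \<Lambda>; \<nu> \<in> mor \<Lambda>; src \<Lambda> \<mu> = rng \<Lambda> \<nu>\<rbrakk>
          \<Longrightarrow> deg \<Lambda> (cmp \<Lambda> \<mu> \<nu>) = add_deg (deg \<Lambda> \<mu>) (deg \<Lambda> \<nu>)"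
    and factorization: "\<lbrakk>\<kappa> \<in> mor \<Lambda>; m \<in> degrees k; n \<in> degrees k; deg \<Lambda> \<kappa> = add_deg m n\<rbrakk>
          \<Longrightarrow> \<exists>!p. fst p \<in> paths \<Lambda> m \<and> snd p \<in> paths \<Lambda> n \<and> src \<Lambda> (fst p) = rng \<Lambda> (snd p)
                 \<and> \<kappa> = cmp \<Lambda> (fst p) (snd p)"

locale finite_k_graph = k_graph +
  assumes finite_paths: "m \<in> degrees k \<Longrightarrow> finite (paths \<Lambda> m)"

definition prod_kgraph :: "nat \<Rightarrow> 'a kgraph \<Rightarrow> 'b kgraph \<Rightarrow> ('a \<times> 'b) kgraph" where
  "prod_kgraph k1 \<Lambda>1 \<Lambda>2 =
    \<lparr> mor = mor \<Lambda>1 \<times> mor \<Lambda>2,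
      rng = map_prod (rng \<Lambda>1) (rng \<Lambda>2),
      src = map_prod (src \<Lambda>1) (src \<Lambda>2),
      cmp = (\<lambda>p q. (cmp \<Lambda>1 (fst p) (fst q), cmp \<Lambda>2 (snd p) (snd q))),
      deg = (\<lambda>p i. if i < k1 then deg \<Lambda>1 (fst p) i else deg \<Lambda>2 (snd p) (i - k1)) \<rparr>"


section \<open>Semibranching function systems\<close>

text \<open>
  A partial map on the space of \<open>M\<close> is a pair of a set (its domain) and a total function whose
  values outside the domain are irrelevant. Sets and partial maps are compared up to null sets;
  equality of partial maps includes equality of their domains.
\<close>

definition ae_subset :: "'x measure \<Rightarrow> 'x set \<Rightarrow> 'x set \<Rightarrow> bool" where
  "ae_subset M A B \<longleftrightarrow> (AE x in M. x \<in> A \<longrightarrow> x \<in> B)"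

definition ae_eq_set :: "'x measure \<Rightarrow> 'x set \<Rightarrow> 'x set \<Rightarrow> bool" where
  "ae_eq_set M A B \<longleftrightarrow> (AE x in M. x \<in> A \<longleftrightarrow> x \<in> B)"

definition ae_eq_map ::
    "'x measure \<Rightarrow> 'x set \<Rightarrow> ('x \<Rightarrow> 'x) \<Rightarrow> 'x set \<Rightarrow> ('x \<Rightarrow> 'x) \<Rightarrow> bool" where
  "ae_eq_map M A f B g \<longleftrightarrow> ae_eq_set M A B \<and> (AE x in M. x \<in> A \<inter> B \<longrightarrow> f x = g x)"

definition comp_dom :: "'x set \<Rightarrow> 'x set \<Rightarrow> ('x \<Rightarrow> 'x) \<Rightarrow> 'x set" where
  "comp_dom A B g = {x \<in> B. g x \<in> A}"

text \<open>
  The last two conditions say that \<open>E \<mapsto> \<mu> (\<sigma> i ` E)\<close> is defined on the measurable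
  subsets of \<open>D i\<close> and has an almost everywhere positive Radon-Nikodym derivative \<open>\<Phi>\<close> with respect
  to \<open>\<mu>\<close> there; in particular the ranges \<open>\<sigma> i ` D i\<close> are measurable.
\<close>

locale semibranching =
  fixes M :: "'x measure" and I :: "'i set" and D :: "'i \<Rightarrow> 'x set" and \<sigma> :: "'i \<Rightarrow> 'x \<Rightarrow> 'x"
  assumes finite_index: "finite I"
    and dom_sets: "i \<in> I \<Longrightarrow> D i \<in> sets M"
    and map_measurable: "i \<in> I \<Longrightarrow> \<sigma> i \<in> measurable (restrict_space M (D i)) M"
    and ranges_cover: "emeasure M (space M - (\<Union>i\<in>I. \<sigma> i ` D i)) = 0"
    and ranges_disjoint: "\<lbrakk>i \<in> I; j \<in> I; i \<noteq> j\<rbrakk> \<Longrightarrow> emeasure M (\<sigma> i ` D i \<inter> \<sigma> j ` D j) = 0"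
    and image_sets: "\<lbrakk>i \<in> I; E \<in> sets M; E \<subseteq> D i\<rbrakk> \<Longrightarrow> \<sigma> i ` E \<in> sets M"
    and RN_derivative_pos: "i \<in> I \<Longrightarrow> \<exists>\<Phi> \<in> borel_measurable M.
          (\<forall>E\<in>sets M. E \<subseteq> D i \<longrightarrow> emeasure M (\<sigma> i ` E) = (\<integral>\<^sup>+x\<in>E. \<Phi> x \<partial>M)) \<and>
          (AE x in M. x \<in> D i \<longrightarrow> 0 < \<Phi> x)"

definition coding_map ::
    "'x measure \<Rightarrow> 'i set \<Rightarrow> ('i \<Rightarrow> 'x set) \<Rightarrow> ('i \<Rightarrow> 'x \<Rightarrow> 'x) \<Rightarrow> ('x \<Rightarrow> 'x) \<Rightarrow> bool" where
  "coding_map M I D \<sigma> s \<longleftrightarrow> s \<in> measurable M M \<and> (\<forall>i\<in>I. \<forall>x\<in>D i. s (\<sigma> i x) = x)"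

locale Lambda_semibranching =
  fixes k :: nat and \<Lambda> :: "'a kgraph" and M :: "'x measure"
    and D :: "'a \<Rightarrow> 'x set" and \<tau> :: "'a \<Rightarrow> 'x \<Rightarrow> 'x" and T :: "(nat \<Rightarrow> nat) \<Rightarrow> 'x \<Rightarrow> 'x"
  assumes semibranching_paths: "m \<in> degrees k \<Longrightarrow> semibranching M (paths \<Lambda> m) D \<tau>"
    and coding: "m \<in> degrees k \<Longrightarrow> coding_map M (paths \<Lambda> m) D \<tau> (T m)"
    and vertex_map: "\<lbrakk>v \<in> verts \<Lambda>; x \<in> D v\<rbrakk> \<Longrightarrow> \<tau> v x = x"
    and vertex_pos: "v \<in> verts \<Lambda> \<Longrightarrow> emeasure M (D v) > 0"
    and range_subset: "\<lbrakk>\<kappa> \<in> mor \<Lambda>; \<nu> \<in> mor \<Lambda>; src \<Lambda> \<kappa> = rng \<Lambda> \<nu>\<rbrakk> \<Longrightarrow> ae_subset M (\<tau> \<nu> ` D \<nu>) (D \<kappa>)"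
    and map_comp: "\<lbrakk>\<kappa> \<in> mor \<Lambda>; \<nu> \<in> mor \<Lambda>; src \<Lambda> \<kappa> = rng \<Lambda> \<nu>\<rbrakk> \<Longrightarrow>
          ae_eq_map M (comp_dom (D \<kappa>) (D \<nu>) (\<tau> \<nu>)) (\<tau> \<kappa> \<circ> \<tau> \<nu>) (D (cmp \<Lambda> \<kappa> \<nu>)) (\<tau> (cmp \<Lambda> \<kappa> \<nu>))"
    and coding_comp: "\<lbrakk>m \<in> degrees k; n \<in> degrees k; x \<in> space M\<rbrakk> \<Longrightarrow> T m (T n x) = T (add_deg m n) x"


section \<open>Systems given on edges\<close>

text \<open>
  Conditions (i)--(v) on a family of vertex domains \<open>Dv\<close>, edge domains \<open>De\<close>, edge prefixing maps
  \<open>\<tau>\<close> and coding maps \<open>Te i\<close> attached to the \<open>i\<close>-th basis vector.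
\<close>

locale edge_conditions =
  fixes k :: nat and \<Lambda> :: "'a kgraph" and M :: "'x measure"
    and Dv :: "'a \<Rightarrow> 'x set" and De :: "'a \<Rightarrow> 'x set" and \<tau> :: "'a \<Rightarrow> 'x \<Rightarrow> 'x"
    and Te :: "nat \<Rightarrow> 'x \<Rightarrow> 'x"
  assumes cond_i_dom: "\<lbrakk>f \<in> edges \<Lambda>; g \<in> edges \<Lambda>; u \<in> verts \<Lambda>; src \<Lambda> f = u; src \<Lambda> g = u\<rbrakk>
          \<Longrightarrow> ae_eq_set M (De f) (De g) \<and> ae_eq_set M (De f) (Dv u)"
    and cond_i_pos: "u \<in> verts \<Lambda> \<Longrightarrow> emeasure M (Dv u) > 0"
    and cond_ii: "\<lbrakk>u \<in> verts \<Lambda>; u' \<in> verts \<Lambda>; u \<noteq> u'\<rbrakk> \<Longrightarrow> emeasure M (Dv u \<inter> Dv u') = 0"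
    and cond_iii: "\<lbrakk>i < k; j < k; f \<in> paths \<Lambda> (unit_deg i); \<beta> \<in> paths \<Lambda> (unit_deg i);
            g \<in> paths \<Lambda> (unit_deg j); \<alpha> \<in> paths \<Lambda> (unit_deg j);
            src \<Lambda> f = rng \<Lambda> \<alpha>; src \<Lambda> g = rng \<Lambda> \<beta>; cmp \<Lambda> f \<alpha> = cmp \<Lambda> g \<beta>\<rbrakk>
          \<Longrightarrow> ae_subset M (\<tau> \<alpha> ` De \<alpha>) (De f) \<and> ae_subset M (\<tau> \<beta> ` De \<beta>) (De g) \<and>
              ae_eq_map M (comp_dom (De f) (De \<alpha>) (\<tau> \<alpha>)) (\<tau> f \<circ> \<tau> \<alpha>)
                          (comp_dom (De g) (De \<beta>) (\<tau> \<beta>)) (\<tau> g \<circ> \<tau> \<beta>)"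
    and cond_iv: "\<lbrakk>i < k; j < k; x \<in> space M\<rbrakk> \<Longrightarrow> Te i (Te j x) = Te j (Te i x)"
    and cond_v: "\<lbrakk>u \<in> verts \<Lambda>; i < k\<rbrakk>
          \<Longrightarrow> emeasure M (Dv u - (\<Union>g\<in>{g \<in> paths \<Lambda> (unit_deg i). rng \<Lambda> g = u}. \<tau> g ` De g)) = 0"

text \<open>\<open>edge_fact \<Lambda> [f\<^sub>1, \<dots>, f\<^sub>n] \<kappa>\<close>: the edges \<open>f\<^sub>1, \<dots>, f\<^sub>n\<close> are composable with product \<open>\<kappa>\<close>;
  the empty list factors the vertices.\<close>

fun edge_fact :: "'a kgraph \<Rightarrow> 'a list \<Rightarrow> 'a \<Rightarrow> bool" where
  "edge_fact \<Lambda> [] \<kappa> \<longleftrightarrow> \<kappa> \<in> verts \<Lambda>"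
| "edge_fact \<Lambda> (f # fs) \<kappa> \<longleftrightarrow>
     f \<in> edges \<Lambda> \<and> (\<exists>\<mu>. edge_fact \<Lambda> fs \<mu> \<and> src \<Lambda> f = rng \<Lambda> \<mu> \<and> \<kappa> = cmp \<Lambda> f \<mu>)"

fun path_map :: "('a \<Rightarrow> 'x \<Rightarrow> 'x) \<Rightarrow> 'a list \<Rightarrow> 'x \<Rightarrow> 'x" where
  "path_map \<tau> [] = id"
| "path_map \<tau> (f # fs) = \<tau> f \<circ> path_map \<tau> fs"

text \<open>The domain of the composite, where \<open>B\<close> is the vertex domain of the source of the path, i.e. the
  domain of the empty composite.\<close>

fun path_dom :: "'x set \<Rightarrow> ('a \<Rightarrow> 'x set) \<Rightarrow> ('a \<Rightarrow> 'x \<Rightarrow> 'x) \<Rightarrow> 'a list \<Rightarrow> 'x set" where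
  "path_dom B D \<tau> [] = B"
| "path_dom B D \<tau> (f # fs) = comp_dom (D f) (path_dom B D \<tau> fs) (path_map \<tau> fs)"

definition coding_power :: "nat \<Rightarrow> (nat \<Rightarrow> 'x \<Rightarrow> 'x) \<Rightarrow> (nat \<Rightarrow> nat) \<Rightarrow> 'x \<Rightarrow> 'x" where
  "coding_power k Te m = foldr (\<lambda>i h. (Te i ^^ m i) \<circ> h) [0..<k] id"


section \<open>The product system\<close>

definition prod_vertex_dom :: "('a \<Rightarrow> 'x set) \<Rightarrow> ('b \<Rightarrow> 'y set) \<Rightarrow> 'a \<times> 'b \<Rightarrow> ('x \<times> 'y) set" where
  "prod_vertex_dom D1 D2 u = D1 (fst u) \<times> D2 (snd u)"

text \<open>
  An edge of the product graph is either \<open>(\<kappa>, v)\<close> with \<open>\<kappa>\<close> an edge and \<open>v\<close> a vertex, or \<open>(w, \<eta>)\<close>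
  with \<open>w\<close> a vertex and \<open>\<eta>\<close> an edge; the test on the degree of the second component separates
  the two cases.

  The map \<open>(x, y) \<mapsto> (\<tau>1 \<kappa> x, y)\<close> only makes sense where \<open>\<tau>1 \<kappa>\<close> is defined. Since \<open>D1 \<kappa>\<close> and
  \<open>D1 (src \<Lambda>1 \<kappa>)\<close> agree only up to a null set, its domain is the part of
  \<open>D1 (src \<Lambda>1 \<kappa>) \<times> D2 v\<close> with first coordinate in \<open>D1 \<kappa>\<close>, and symmetrically for the other edges.
  This changes the domain by a null set.
\<close>

definition prod_edge_dom ::
    "'a kgraph \<Rightarrow> 'b kgraph \<Rightarrow> ('a \<Rightarrow> 'x set) \<Rightarrow> ('b \<Rightarrow> 'y set) \<Rightarrow> 'a \<times> 'b \<Rightarrow> ('x \<times> 'y) set" where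
  "prod_edge_dom \<Lambda>1 \<Lambda>2 D1 D2 f =
     (if deg \<Lambda>2 (snd f) = zero_deg
      then {p \<in> prod_vertex_dom D1 D2 (src \<Lambda>1 (fst f), snd f). fst p \<in> D1 (fst f)}
      else {p \<in> prod_vertex_dom D1 D2 (fst f, src \<Lambda>2 (snd f)). snd p \<in> D2 (snd f)})"

definition prod_edge_map ::
    "'b kgraph \<Rightarrow> ('a \<Rightarrow> 'x \<Rightarrow> 'x) \<Rightarrow> ('b \<Rightarrow> 'y \<Rightarrow> 'y) \<Rightarrow> 'a \<times> 'b \<Rightarrow> 'x \<times> 'y \<Rightarrow> 'x \<times> 'y" where
  "prod_edge_map \<Lambda>2 \<tau>1 \<tau>2 f =
     (if deg \<Lambda>2 (snd f) = zero_deg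
      then (\<lambda>(x, y). (\<tau>1 (fst f) x, y))
      else (\<lambda>(x, y). (x, \<tau>2 (snd f) y)))"

definition prod_edge_coding ::
    "nat \<Rightarrow> ((nat \<Rightarrow> nat) \<Rightarrow> 'x \<Rightarrow> 'x) \<Rightarrow> ((nat \<Rightarrow> nat) \<Rightarrow> 'y \<Rightarrow> 'y) \<Rightarrow> nat \<Rightarrow> 'x \<times> 'y \<Rightarrow> 'x \<times> 'y" where
  "prod_edge_coding k1 T1 T2 j =
     (if j < k1
      then (\<lambda>(x, y). (T1 (unit_deg j) x, y))
      else (\<lambda>(x, y). (x, T2 (unit_deg (j - k1)) y)))"

end

theory Submission
  imports Defs
begin

text \<open>
  On its domain the prefixing map \<open>(x, y) \<mapsto> (\<tau>1 \<kappa> x, y)\<close> of an edge \<open>(\<kappa>, v)\<close> is the product map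
  \<open>\<tau>1 \<kappa> \<times> \<tau>2 v\<close>, because the map of a vertex is the identity; symmetrically for the edges \<open>(w, \<eta>)\<close>.
  So the edge maps are, up to null sets, part of the family \<open>\<tau>1 \<kappa> \<times> \<tau>2 \<nu>\<close> on \<open>D1 \<kappa> \<times> D2 \<nu>\<close> that is
  indexed by all morphisms \<open>(\<kappa>, \<nu>)\<close> of the product graph. This family is a semibranching function
  system of the product graph (\<open>prod_system\<close>): almost every condition can be read off coordinate by
  coordinate, since a null set of one factor spans a null cylinder.

  The condition that is not coordinatewise is the positive Radon-Nikodym derivative, as it concerns
  images of sets that are not rectangles. It becomes easy after a reformulation: in the presence of a
  coding map and a sigma-finite measure, having a positive Radon-Nikodym derivative means exactly
  that null sets correspond to null sets under the map. Maps of this kind, here called nonsingular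
  branches, are closed under products by Fubini's theorem (\<open>nonsingular_branch_map_prod\<close>) and
  closed under composition for trivial reasons (\<open>nonsingular_branch_comp\<close>), so no densities are
  ever computed.

  What is left does not mention products. Suppose that a family of maps on the edges of a \<open>k\<close>-graph
  agrees almost everywhere with the edge maps of a semibranching function system, and has commuting
  coding maps (locale \<open>edge_presentation\<close>). Equality almost everywhere survives composition with
  nonsingular branches, and so does equality of ranges. Hence conditions (i)--(v) are inherited from
  the given system (\<open>satisfies_edge_conditions\<close>), and the composites along any choice of
  factorizations into edges agree almost everywhere with the given prefixing maps and form a system
  again (\<open>path_system\<close>).
\<close>

section \<open>Nonsingular branches\<close>

text \<open>
  The left inverse \<open>s\<close> is a measurable map of the whole space. It turns images into preimages,
  which is how images of measurable sets are seen to be measurable.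
\<close>

locale nonsingular_branch =
  fixes M :: "'x measure" and D :: "'x set" and \<sigma> :: "'x \<Rightarrow> 'x" and s :: "'x \<Rightarrow> 'x"
  assumes dom_sets: "D \<in> sets M"
    and map_measurable: "\<sigma> \<in> measurable (restrict_space M D) M"
    and inverse_measurable: "s \<in> measurable M M"
    and left_inverse: "x \<in> D \<Longrightarrow> s (\<sigma> x) = x"
    and range_sets: "\<sigma> ` D \<in> sets M"
    and null_image_iff: "\<lbrakk>E \<in> sets M; E \<subseteq> D\<rbrakk> \<Longrightarrow> emeasure M (\<sigma> ` E) = 0 \<longleftrightarrow> emeasure M E = 0"
begin

lemma dom_space: "x \<in> D \<Longrightarrow> x \<in> space M"
  using dom_sets sets.sets_into_space by blast

lemma map_space: "x \<in> D \<Longrightarrow> \<sigma> x \<in> space M"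
  using range_sets sets.sets_into_space by blast

lemma image_sets:
  assumes "E \<in> sets M" "E \<subseteq> D"
  shows "\<sigma> ` E \<in> sets M"
proof -
  have "\<sigma> ` E = (s -` E \<inter> space M) \<inter> \<sigma> ` D"
    using assms left_inverse map_space by (force simp: image_iff)
  then show ?thesis
    using measurable_sets[OF inverse_measurable assms(1)] range_sets by auto
qed

lemma preimage_sets:
  assumes "E \<in> sets M"
  shows "{x \<in> D. \<sigma> x \<in> E} \<in> sets M"
proof -
  have "\<sigma> -` E \<inter> space (restrict_space M D) \<in> sets (restrict_space M D)"
    using map_measurable assms by (rule measurable_sets)
  moreover have "\<sigma> -` E \<inter> space (restrict_space M D) = {x \<in> D. \<sigma> x \<in> E}"
    using dom_space by (auto simp: space_restrict_space)
  ultimately show ?thesis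
    using dom_sets by (simp add: sets_restrict_space_iff)
qed

text \<open>The image under \<open>\<sigma>\<close> of the exceptional null set is null. Together with \<open>AE_pull\<close> this is how the
  two directions of \<open>null_image_iff\<close> are used: properties that hold almost everywhere can be
  transported along \<open>\<sigma>\<close> both ways.\<close>

lemma AE_push:
  assumes "AE x in M. P x"
  shows "AE y in M. y \<in> \<sigma> ` D \<longrightarrow> P (s y)"
proof -
  from assms obtain N where N: "N \<in> null_sets M" "{x \<in> space M. \<not> P x} \<subseteq> N"
    by (auto simp: eventually_ae_filter)
  have "N \<inter> D \<in> null_sets M"
    using N(1) dom_sets by (rule null_set_Int2)
  then have "\<sigma> ` (N \<inter> D) \<in> null_sets M"
    using null_image_iff[of "N \<inter> D"] image_sets[of "N \<inter> D"] by (auto simp: null_sets_def)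
  moreover have "{y \<in> space M. \<not> (y \<in> \<sigma> ` D \<longrightarrow> P (s y))} \<subseteq> \<sigma> ` (N \<inter> D)"
  proof
    fix y assume "y \<in> {y \<in> space M. \<not> (y \<in> \<sigma> ` D \<longrightarrow> P (s y))}"
    then obtain x where "x \<in> D" "y = \<sigma> x" "\<not> P (s y)"
      by auto
    then show "y \<in> \<sigma> ` (N \<inter> D)"
      using N(2) left_inverse dom_space by auto
  qed
  ultimately show ?thesis
    by (rule AE_I')
qed

lemma AE_pull:
  assumes "AE y in M. Q y"
  shows "AE x in M. x \<in> D \<longrightarrow> Q (\<sigma> x)"
proof -
  from assms obtain N where N: "N \<in> null_sets M" "{x \<in> space M. \<not> Q x} \<subseteq> N"
    by (auto simp: eventually_ae_filter)
  let ?E = "{x \<in> D. \<sigma> x \<in> N}"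
  have E: "?E \<in> sets M"
    using N(1) by (intro preimage_sets) auto
  moreover have "\<sigma> ` ?E \<in> null_sets M"
    using N(1) image_sets[OF E] by (intro null_sets_subset[OF N(1)]) auto
  ultimately have "?E \<in> null_sets M"
    using null_image_iff[of ?E] by (auto simp: null_sets_def)
  moreover have "{x \<in> space M. \<not> (x \<in> D \<longrightarrow> Q (\<sigma> x))} \<subseteq> ?E"
    using N(2) map_space by auto
  ultimately show ?thesis
    by (rule AE_I')
qed

text \<open>The set function \<open>E \<mapsto> \<mu> (\<sigma> ` E)\<close> is absolutely continuous by one direction of
  \<open>null_image_iff\<close>, so the Radon-Nikodym theorem gives a density. The other direction makes the
  density positive: \<open>\<sigma>\<close> maps its zero set to a null set, so the zero set is null.\<close>

lemma positive_RN_derivative: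
  assumes "sigma_finite_measure M"
  shows "\<exists>\<Phi> \<in> borel_measurable M.
          (\<forall>E\<in>sets M. E \<subseteq> D \<longrightarrow> emeasure M (\<sigma> ` E) = (\<integral>\<^sup>+x\<in>E. \<Phi> x \<partial>M)) \<and>
          (AE x in M. x \<in> D \<longrightarrow> 0 < \<Phi> x)"
proof -
  interpret sigma_finite_measure M by fact
  \<comment> \<open>Since \<open>s\<close> inverts \<open>\<sigma>\<close>, pushing forward by \<open>s\<close> the measure on the range makes \<open>E \<mapsto> \<mu> (\<sigma> ` (E \<inter> D))\<close>
    a measure, with countable additivity for free.\<close>
  define N where "N = distr (restrict_space M (\<sigma> ` D)) M s"
  have s: "s \<in> measurable (restrict_space M (\<sigma> ` D)) M"
    using inverse_measurable by (rule measurable_restrict_space1)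
  have N: "emeasure N E = emeasure M (\<sigma> ` (E \<inter> D))" if "E \<in> sets M" for E
  proof -
    have "s -` E \<inter> space (restrict_space M (\<sigma> ` D)) = \<sigma> ` (E \<inter> D)"
      using left_inverse map_space by (auto simp: space_restrict_space)
    then have "emeasure N E = emeasure (restrict_space M (\<sigma> ` D)) (\<sigma> ` (E \<inter> D))"
      unfolding N_def emeasure_distr[OF s that] by (rule arg_cong)
    also have "\<dots> = emeasure M (\<sigma> ` (E \<inter> D))"
      by (rule emeasure_restrict_space) (use range_sets in auto)
    finally show ?thesis .
  qed
  have "absolutely_continuous M N"
    unfolding absolutely_continuous_def
  proof
    fix E assume "E \<in> null_sets M"
    moreover from this dom_sets have "E \<inter> D \<in> null_sets M"
      by (rule null_set_Int2)
    ultimately show "E \<in> null_sets N"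
      using N[of E] null_image_iff[of "E \<inter> D"] by (auto simp: null_sets_def N_def)
  qed
  then obtain \<Phi> where \<Phi>: "\<Phi> \<in> borel_measurable M" "density M \<Phi> = N"
    using Radon_Nikodym[of N] by (auto simp: N_def)
  have eq: "emeasure M (\<sigma> ` E) = (\<integral>\<^sup>+x\<in>E. \<Phi> x \<partial>M)" if "E \<in> sets M" "E \<subseteq> D" for E
    using that N[of E] emeasure_density[OF \<Phi>(1) that(1)] \<Phi>(2) by (simp add: Int_absorb2)
  let ?Z = "{x \<in> D. \<Phi> x = 0}"
  have Z: "?Z \<in> sets M"
  proof -
    have "?Z = D \<inter> {x \<in> space M. \<Phi> x = 0}"
      using dom_space by auto
    then show ?thesis
      using \<Phi>(1) dom_sets by simp
  qed
  have "(\<integral>\<^sup>+x\<in>?Z. \<Phi> x \<partial>M) = (\<integral>\<^sup>+x. 0 \<partial>M)"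
    by (intro nn_integral_cong) (auto simp: indicator_def)
  then have "emeasure M (\<sigma> ` ?Z) = 0"
    using eq[OF Z] by auto
  then have "?Z \<in> null_sets M"
    using null_image_iff[OF Z] Z by auto
  then have "AE x in M. x \<notin> ?Z"
    by (rule AE_not_in)
  then have "AE x in M. x \<in> D \<longrightarrow> 0 < \<Phi> x"
    by eventually_elim (auto simp: zero_less_iff_neq_zero)
  with \<Phi>(1) eq show ?thesis
    by blast
qed

text \<open>The left inverse may be exchanged as well. This matters because a composite or a product of
  branches comes with a composite or a product of left inverses, whereas all paths of one degree have
  to share a single coding map.\<close>

lemma restrict:
  assumes "A \<in> sets M" "A \<subseteq> D" "\<And>x. x \<in> A \<Longrightarrow> \<rho> x = \<sigma> x"
    and "t \<in> measurable M M" "\<And>x. x \<in> A \<Longrightarrow> t (\<rho> x) = x"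
  shows "nonsingular_branch M A \<rho> t"
proof -
  have im: "\<rho> ` E = \<sigma> ` E" if "E \<subseteq> A" for E
    using that assms(3) by (intro image_cong) auto
  have "\<sigma> \<in> measurable (restrict_space M A) M"
    using measurable_restrict_mono[OF map_measurable assms(2)] .
  then have m: "\<rho> \<in> measurable (restrict_space M A) M"
    using assms(3) by (subst measurable_cong[where g = \<sigma>]) (auto simp: space_restrict_space)
  show ?thesis
  proof
    show "\<rho> ` A \<in> sets M"
      using image_sets[OF assms(1,2)] im by simp
    show "emeasure M (\<rho> ` E) = 0 \<longleftrightarrow> emeasure M E = 0" if "E \<in> sets M" "E \<subseteq> A" for E
      using null_image_iff[of E] im[of E] that assms(2) by simp
  qed (use assms m in auto)
qed

end

lemma nonsingular_branch_comp:
  assumes "nonsingular_branch M A \<sigma> s" "nonsingular_branch M B \<rho> t"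
  shows "nonsingular_branch M (comp_dom A B \<rho>) (\<sigma> \<circ> \<rho>) (t \<circ> s)"
proof -
  interpret S: nonsingular_branch M A \<sigma> s by fact
  interpret R: nonsingular_branch M B \<rho> t by fact
  let ?C = "comp_dom A B \<rho>"
  have C: "?C \<in> sets M"
    unfolding comp_dom_def by (rule R.preimage_sets[OF S.dom_sets])
  have sub: "?C \<subseteq> B" "\<rho> ` ?C \<subseteq> A"
    by (auto simp: comp_dom_def)
  have "\<rho> \<in> measurable (restrict_space M ?C) (restrict_space M A)"
    using measurable_restrict_mono[OF R.map_measurable sub(1)] sub(2)
    by (intro measurable_restrict_space2) (auto simp: space_restrict_space)
  then have m: "\<sigma> \<circ> \<rho> \<in> measurable (restrict_space M ?C) M"
    using S.map_measurable by (rule measurable_comp)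
  show ?thesis
  proof
    show "?C \<in> sets M" by fact
    show "\<sigma> \<circ> \<rho> \<in> measurable (restrict_space M ?C) M" by fact
    show "t \<circ> s \<in> measurable M M"
      using S.inverse_measurable R.inverse_measurable by (rule measurable_comp)
    show "(t \<circ> s) ((\<sigma> \<circ> \<rho>) x) = x" if "x \<in> ?C" for x
      using that S.left_inverse R.left_inverse by (auto simp: comp_dom_def)
    show "(\<sigma> \<circ> \<rho>) ` ?C \<in> sets M"
      using S.image_sets[OF R.image_sets[OF C sub(1)] sub(2)] by (simp add: image_comp)
    show "emeasure M ((\<sigma> \<circ> \<rho>) ` E) = 0 \<longleftrightarrow> emeasure M E = 0" if E: "E \<in> sets M" "E \<subseteq> ?C" for E
    proof -
      have "E \<subseteq> B" "\<rho> ` E \<subseteq> A"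
        using E(2) by (auto simp: comp_dom_def)
      then show ?thesis
        using S.null_image_iff[of "\<rho> ` E"] R.null_image_iff[of E] R.image_sets[of E] E(1)
        by (simp add: image_comp)
    qed
  qed
qed

lemma AE_pair_fst:
  assumes "sigma_finite_measure M2" "AE x in M1. P x"
  shows "AE p in M1 \<Otimes>\<^sub>M M2. P (fst p)"
proof -
  interpret sigma_finite_measure M2 by fact
  from assms(2) obtain N where N: "N \<in> null_sets M1" "{x \<in> space M1. \<not> P x} \<subseteq> N"
    by (auto simp: eventually_ae_filter)
  show ?thesis
    by (rule AE_I'[OF times_in_null_sets1[OF N(1) sets.top]]) (use N(2) in \<open>auto simp: space_pair_measure\<close>)
qed

lemma AE_pair_snd:
  assumes "sigma_finite_measure M2" "AE y in M2. P y"
  shows "AE p in M1 \<Otimes>\<^sub>M M2. P (snd p)"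
proof -
  interpret sigma_finite_measure M2 by fact
  from assms(2) obtain N where N: "N \<in> null_sets M2" "{x \<in> space M2. \<not> P x} \<subseteq> N"
    by (auto simp: eventually_ae_filter)
  show ?thesis
    by (rule AE_I'[OF times_in_null_sets2[OF sets.top N(1)]]) (use N(2) in \<open>auto simp: space_pair_measure\<close>)
qed

text \<open>A set is null in the product iff almost all of its slices are null. Transporting this along
  \<open>\<sigma>\<close> in the first and along \<open>\<rho>\<close> in the second variable shows that \<open>E\<close> and its image are
  null together, although \<open>E\<close> need not be a rectangle.\<close>

lemma nonsingular_branch_map_prod:
  fixes M1 :: "'x measure" and M2 :: "'y measure"
  assumes "sigma_finite_measure M1" "sigma_finite_measure M2"
    and "nonsingular_branch M1 A \<sigma> s" "nonsingular_branch M2 B \<rho> t"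
  shows "nonsingular_branch (M1 \<Otimes>\<^sub>M M2) (A \<times> B) (map_prod \<sigma> \<rho>) (map_prod s t)"
proof -
  interpret M1: sigma_finite_measure M1 by fact
  interpret M2: sigma_finite_measure M2 by fact
  interpret pair_sigma_finite M1 M2 by unfold_locales
  interpret S: nonsingular_branch M1 A \<sigma> s by fact
  interpret R: nonsingular_branch M2 B \<rho> t by fact
  let ?M = "M1 \<Otimes>\<^sub>M M2" and ?\<omega> = "map_prod \<sigma> \<rho>" and ?u = "map_prod s t"
  have dom: "A \<times> B \<in> sets ?M"
    using S.dom_sets R.dom_sets by auto
  have ran: "?\<omega> ` (A \<times> B) \<in> sets ?M"
  proof -
    have "?\<omega> ` (A \<times> B) = \<sigma> ` A \<times> \<rho> ` B"
      by auto
    then show ?thesis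
      using S.range_sets R.range_sets by auto
  qed
  have inv: "?u \<in> measurable ?M ?M"
    using S.inverse_measurable R.inverse_measurable unfolding map_prod_def by measurable
  have left: "?u (?\<omega> p) = p" if "p \<in> A \<times> B" for p
    using that S.left_inverse R.left_inverse by auto
  have meas: "?\<omega> \<in> measurable (restrict_space ?M (A \<times> B)) ?M"
  proof -
    have "fst \<in> measurable (restrict_space ?M (A \<times> B)) (restrict_space M1 A)"
      by (intro measurable_restrict_space3) auto
    then have 1: "\<sigma> \<circ> fst \<in> measurable (restrict_space ?M (A \<times> B)) M1"
      using S.map_measurable by (rule measurable_comp)
    have "snd \<in> measurable (restrict_space ?M (A \<times> B)) (restrict_space M2 B)"
      by (intro measurable_restrict_space3) auto
    then have 2: "\<rho> \<circ> snd \<in> measurable (restrict_space ?M (A \<times> B)) M2"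
      using R.map_measurable by (rule measurable_comp)
    have "(\<lambda>p. ((\<sigma> \<circ> fst) p, (\<rho> \<circ> snd) p)) \<in> measurable (restrict_space ?M (A \<times> B)) ?M"
      using 1 2 by (rule measurable_Pair)
    then show ?thesis
      by (simp add: map_prod_def case_prod_unfold)
  qed
  show ?thesis
  proof
    show "emeasure ?M (?\<omega> ` E) = 0 \<longleftrightarrow> emeasure ?M E = 0"
      if E: "E \<in> sets ?M" "E \<subseteq> A \<times> B" for E
    proof -
      have "?\<omega> ` E = (?u -` E \<inter> space ?M) \<inter> ?\<omega> ` (A \<times> B)"
      proof (intro set_eqI iffI)
        fix q assume "q \<in> ?\<omega> ` E"
        then obtain p where p: "p \<in> E" "q = ?\<omega> p"
          by auto
        then have "q \<in> ?\<omega> ` (A \<times> B)"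
          using E(2) by auto
        then show "q \<in> (?u -` E \<inter> space ?M) \<inter> ?\<omega> ` (A \<times> B)"
          using p left[of p] E(2) sets.sets_into_space[OF ran] by auto
      next
        fix q assume "q \<in> (?u -` E \<inter> space ?M) \<inter> ?\<omega> ` (A \<times> B)"
        then obtain p where p: "p \<in> A \<times> B" "q = ?\<omega> p" and "?u q \<in> E"
          by (elim IntE imageE) simp
        then have "p \<in> E"
          using left[OF p(1)] by simp
        with p(2) show "q \<in> ?\<omega> ` E"
          by (rule image_eqI)
      qed
      then have im: "?\<omega> ` E \<in> sets ?M"
        using measurable_sets[OF inv E(1)] ran by auto
      have "(AE p in ?M. p \<notin> ?\<omega> ` E) \<longleftrightarrow> (AE p in ?M. p \<notin> E)"
      proof
        assume "AE p in ?M. p \<notin> ?\<omega> ` E"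
        then have "AE x in M1. AE y in M2. (x, y) \<notin> ?\<omega> ` E"
          by (rule AE_pair)
        from S.AE_pull[OF this] have "AE x in M1. AE y in M2. (x, y) \<notin> E"
        proof eventually_elim
          case (elim x)
          show ?case
          proof (cases "x \<in> A")
            case True
            with elim have "AE y in M2. (\<sigma> x, y) \<notin> ?\<omega> ` E"
              by simp
            from R.AE_pull[OF this] show ?thesis
            proof eventually_elim
              case (elim y)
              show "(x, y) \<notin> E"
              proof
                assume "(x, y) \<in> E"
                then have "y \<in> B" "?\<omega> (x, y) \<in> ?\<omega> ` E"
                  using E(2) by blast+
                with elim show False
                  by simp
              qed
            qed
          qed (use E(2) in auto)
        qed
        then show "AE p in ?M. p \<notin> E"
          using E(1) by (intro AE_pair_measure) auto
      next
        assume "AE p in ?M. p \<notin> E"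
        then have "AE x in M1. AE y in M2. (x, y) \<notin> E"
          by (rule AE_pair)
        from S.AE_push[OF this] have "AE x in M1. AE y in M2. (x, y) \<notin> ?\<omega> ` E"
        proof eventually_elim
          case (elim x)
          show ?case
          proof (cases "x \<in> \<sigma> ` A")
            case True
            with elim have "AE y in M2. (s x, y) \<notin> E"
              by simp
            from R.AE_push[OF this] show ?thesis
            proof eventually_elim
              case (elim y)
              show "(x, y) \<notin> ?\<omega> ` E"
              proof
                assume "(x, y) \<in> ?\<omega> ` E"
                then obtain a b where ab: "(a, b) \<in> E" "x = \<sigma> a" "y = \<rho> b"
                  by auto
                then have "s x = a" "t y = b" "y \<in> \<rho> ` B"
                  using E(2) S.left_inverse R.left_inverse by blast+
                with elim ab(1) show False
                  by simp
              qed
            qed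
          next
            case False
            then have "(x, y) \<notin> ?\<omega> ` E" for y
              using E(2) by auto
            then show ?thesis
              by simp
          qed
        qed
        then show "AE p in ?M. p \<notin> ?\<omega> ` E"
          using im by (intro AE_pair_measure) auto
      qed
      then show ?thesis
        using AE_iff_null_sets[OF E(1)] AE_iff_null_sets[OF im] E(1) im by (auto simp: null_sets_def)
    qed
  qed (use dom ran inv left meas in auto)
qed

section \<open>Partial maps up to null sets\<close>

lemma ae_eq_set_sym:
  assumes "ae_eq_set M A B"
  shows "ae_eq_set M B A"
  using assms unfolding ae_eq_set_def by eventually_elim auto

lemma ae_eq_set_trans:
  assumes "ae_eq_set M A B" "ae_eq_set M B C"
  shows "ae_eq_set M A C"
  using assms unfolding ae_eq_set_def by eventually_elim auto

lemma ae_eq_map_iff: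
  "ae_eq_map M A f B g \<longleftrightarrow> (AE x in M. (x \<in> A \<longleftrightarrow> x \<in> B) \<and> (x \<in> A \<longrightarrow> f x = g x))"
  unfolding ae_eq_map_def ae_eq_set_def AE_conj_iff[symmetric] by (intro AE_cong) auto

lemma ae_eq_map_sym:
  assumes "ae_eq_map M A f B g"
  shows "ae_eq_map M B g A f"
  using assms unfolding ae_eq_map_iff by eventually_elim auto

lemma ae_eq_map_trans:
  assumes "ae_eq_map M A f B g" "ae_eq_map M B g C h"
  shows "ae_eq_map M A f C h"
  using assms unfolding ae_eq_map_iff by eventually_elim auto

lemma ae_eq_map_dom: "ae_eq_map M A f B g \<Longrightarrow> ae_eq_set M A B"
  by (simp add: ae_eq_map_def)

text \<open>Nonsingularity of the inner map is essential: the set where the outer maps differ has to have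
  a null preimage.\<close>

lemma ae_eq_map_comp:
  assumes "nonsingular_branch M B \<rho> t" "ae_eq_map M A \<sigma> A' \<sigma>'" "ae_eq_map M B \<rho> B' \<rho>'"
  shows "ae_eq_map M (comp_dom A B \<rho>) (\<sigma> \<circ> \<rho>) (comp_dom A' B' \<rho>') (\<sigma>' \<circ> \<rho>')"
proof -
  interpret nonsingular_branch M B \<rho> t by fact
  show ?thesis
    using AE_pull[OF assms(2)[unfolded ae_eq_map_iff]] assms(3)
    unfolding ae_eq_map_iff comp_dom_def by eventually_elim auto
qed

text \<open>A map may in general send a null set to a large set, so maps that agree almost everywhere can have
  quite different ranges. Nonsingularity of \<open>\<sigma>\<close> excludes that.\<close>

lemma ae_eq_map_range_subset:
  assumes "nonsingular_branch M A \<sigma> s" "ae_eq_map M A \<sigma> B \<rho>"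
  shows "ae_subset M (\<sigma> ` A) (\<rho> ` B)"
proof -
  interpret nonsingular_branch M A \<sigma> s by fact
  show ?thesis
    using AE_push[OF assms(2)[unfolded ae_eq_map_iff]] unfolding ae_subset_def
  proof eventually_elim
    case (elim y)
    show ?case
    proof
      assume y: "y \<in> \<sigma> ` A"
      then have "s y \<in> A" "\<sigma> (s y) = y"
        using left_inverse by auto
      then show "y \<in> \<rho> ` B"
        using elim y by (intro image_eqI[of _ _ "s y"]) auto
    qed
  qed
qed

lemma ae_eq_map_range:
  assumes "nonsingular_branch M A \<sigma> s" "nonsingular_branch M B \<rho> t" "ae_eq_map M A \<sigma> B \<rho>"
  shows "ae_eq_set M (\<sigma> ` A) (\<rho> ` B)"
  using ae_eq_map_range_subset[OF assms(1,3)] ae_eq_map_range_subset[OF assms(2) ae_eq_map_sym[OF assms(3)]]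
  unfolding ae_eq_set_def ae_subset_def by eventually_elim auto

lemma ae_subset_cong:
  assumes "ae_eq_set M A A'" "ae_eq_set M B B'" "ae_subset M A' B'"
  shows "ae_subset M A B"
  using assms unfolding ae_eq_set_def ae_subset_def by eventually_elim auto

lemma emeasure_eq_0_iff_AE: "S \<in> sets M \<Longrightarrow> emeasure M S = 0 \<longleftrightarrow> (AE x in M. x \<notin> S)"
  using AE_iff_null_sets[of S M] by (auto simp: null_sets_def)

section \<open>Semibranching function systems as families of nonsingular branches\<close>

lemma semibranching_branch:
  assumes "semibranching M I D \<sigma>" "coding_map M I D \<sigma> s" "i \<in> I"
  shows "nonsingular_branch M (D i) (\<sigma> i) s"
proof -
  interpret semibranching M I D \<sigma> by fact
  obtain \<Phi> where \<Phi>: "\<Phi> \<in> borel_measurable M" "AE x in M. x \<in> D i \<longrightarrow> 0 < \<Phi> x"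
      "\<And>E. E \<in> sets M \<Longrightarrow> E \<subseteq> D i \<Longrightarrow> emeasure M (\<sigma> i ` E) = (\<integral>\<^sup>+x\<in>E. \<Phi> x \<partial>M)"
    using RN_derivative_pos[OF assms(3)] by blast
  show ?thesis
  proof
    show "D i \<in> sets M" "\<sigma> i \<in> measurable (restrict_space M (D i)) M" "\<sigma> i ` D i \<in> sets M"
      using assms(3) dom_sets map_measurable image_sets by auto
    show "s (\<sigma> i x) = x" if "x \<in> D i" for x
      using assms(2,3) that by (auto simp: coding_map_def)
    show "s \<in> measurable M M"
      using assms(2) by (auto simp: coding_map_def)
    show "emeasure M (\<sigma> i ` E) = 0 \<longleftrightarrow> emeasure M E = 0" if E: "E \<in> sets M" "E \<subseteq> D i" for E
    proof -
      have "emeasure M (\<sigma> i ` E) = 0 \<longleftrightarrow> (AE x in M. \<Phi> x * indicator E x = 0)"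
        using \<Phi>(1) E by (simp add: \<Phi>(3) nn_integral_0_iff_AE)
      also have "\<dots> \<longleftrightarrow> (AE x in M. x \<notin> E)"
      proof (rule eventually_subst)
        show "AE x in M. (\<Phi> x * indicator E x = 0) = (x \<notin> E)"
          using \<Phi>(2) by eventually_elim (use E(2) in \<open>auto simp: indicator_def\<close>)
      qed
      finally show ?thesis
        using E(1) by (simp add: emeasure_eq_0_iff_AE)
    qed
  qed
qed

lemma semibranchingI:
  assumes "sigma_finite_measure M" "finite I"
    and branch: "\<And>i. i \<in> I \<Longrightarrow> nonsingular_branch M (D i) (\<sigma> i) s"
    and cover: "AE x in M. \<exists>i\<in>I. x \<in> \<sigma> i ` D i"
    and disjoint: "\<And>i j. \<lbrakk>i \<in> I; j \<in> I; i \<noteq> j\<rbrakk> \<Longrightarrow> AE x in M. \<not> (x \<in> \<sigma> i ` D i \<and> x \<in> \<sigma> j ` D j)"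
  shows "semibranching M I D \<sigma>"
proof
  show "finite I" by fact
  fix i assume i: "i \<in> I"
  interpret nonsingular_branch M "D i" "\<sigma> i" s
    using i by (rule branch)
  show "D i \<in> sets M" "\<sigma> i \<in> measurable (restrict_space M (D i)) M"
    by (fact dom_sets map_measurable)+
  show "\<sigma> i ` E \<in> sets M" if "E \<in> sets M" "E \<subseteq> D i" for E
    using that by (rule image_sets)
  show "\<exists>\<Phi> \<in> borel_measurable M.
          (\<forall>E\<in>sets M. E \<subseteq> D i \<longrightarrow> emeasure M (\<sigma> i ` E) = (\<integral>\<^sup>+x\<in>E. \<Phi> x \<partial>M)) \<and>
          (AE x in M. x \<in> D i \<longrightarrow> 0 < \<Phi> x)"
    using assms(1) by (rule positive_RN_derivative)
next
  have ran: "\<sigma> i ` D i \<in> sets M" if "i \<in> I" for i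
    using branch[OF that] by (rule nonsingular_branch.range_sets)
  have "AE x in M. x \<notin> space M - (\<Union>i\<in>I. \<sigma> i ` D i)"
    using cover by eventually_elim auto
  moreover have "space M - (\<Union>i\<in>I. \<sigma> i ` D i) \<in> sets M"
    using ran \<open>finite I\<close> by auto
  ultimately show "emeasure M (space M - (\<Union>i\<in>I. \<sigma> i ` D i)) = 0"
    by (simp only: emeasure_eq_0_iff_AE)
  fix i j assume ij: "i \<in> I" "j \<in> I" "i \<noteq> j"
  have "AE x in M. x \<notin> \<sigma> i ` D i \<inter> \<sigma> j ` D j"
    using disjoint[OF ij] by eventually_elim auto
  then show "emeasure M (\<sigma> i ` D i \<inter> \<sigma> j ` D j) = 0"
    using ran ij by (subst emeasure_eq_0_iff_AE) auto
qed

section \<open>Factorizations into edges\<close>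

lemma zero_deg_degrees: "zero_deg \<in> degrees k"
  by (simp add: zero_deg_def degrees_def)

lemma unit_deg_degrees: "unit_deg i \<in> degrees k \<longleftrightarrow> i < k"
  by (auto simp: unit_deg_def degrees_def not_le[symmetric])

lemma add_deg_commute: "add_deg m n = add_deg n m"
  by (simp add: add_deg_def add.commute)

context k_graph
begin

lemma pathsD: "\<kappa> \<in> paths \<Lambda> m \<Longrightarrow> \<kappa> \<in> mor \<Lambda>" "\<kappa> \<in> paths \<Lambda> m \<Longrightarrow> deg \<Lambda> \<kappa> = m"
  by (auto simp: paths_def)

lemma src_verts: "\<kappa> \<in> mor \<Lambda> \<Longrightarrow> src \<Lambda> \<kappa> \<in> verts \<Lambda>"
  and rng_verts: "\<kappa> \<in> mor \<Lambda> \<Longrightarrow> rng \<Lambda> \<kappa> \<in> verts \<Lambda>"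
  using deg_ident src_mor rng_mor by (auto simp: verts_def paths_def)

lemma verts_mor: "v \<in> verts \<Lambda> \<Longrightarrow> v \<in> mor \<Lambda>"
  and verts_deg: "v \<in> verts \<Lambda> \<Longrightarrow> deg \<Lambda> v = zero_deg"
  by (auto simp: verts_def paths_def)

text \<open>The factorizations \<open>r(v) v\<close> and \<open>v s(v)\<close> of \<open>v\<close> into elements of degree 0 coincide by
  uniqueness.\<close>

lemma vertex_identity:
  assumes "v \<in> verts \<Lambda>"
  shows "src \<Lambda> v = v" "rng \<Lambda> v = v"
proof -
  let ?fac = "\<lambda>p. fst p \<in> paths \<Lambda> zero_deg \<and> snd p \<in> paths \<Lambda> zero_deg \<and>
      src \<Lambda> (fst p) = rng \<Lambda> (snd p) \<and> v = cmp \<Lambda> (fst p) (snd p)"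
  have v: "v \<in> mor \<Lambda>" "deg \<Lambda> v = zero_deg"
    using assms by (auto simp: verts_def paths_def)
  have "\<exists>!p. ?fac p"
    using v zero_deg_degrees by (intro factorization) (auto simp: zero_deg_def add_deg_def)
  moreover have "?fac (rng \<Lambda> v, v)" "?fac (v, src \<Lambda> v)"
    using v rng_ident src_ident comp_rng comp_src deg_ident rng_mor src_mor
    by (auto simp: paths_def)
  ultimately have "(rng \<Lambda> v, v) = (v, src \<Lambda> v)"
    by blast
  then show "src \<Lambda> v = v" "rng \<Lambda> v = v"
    by auto
qed

lemma edge_degree:
  assumes "f \<in> edges \<Lambda>"
  obtains i where "i < k" "f \<in> paths \<Lambda> (unit_deg i)"
proof -
  obtain i where i: "f \<in> paths \<Lambda> (unit_deg i)"
    using assms by (auto simp: edges_def)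
  then have "i < k"
    using deg_degrees[of f] by (auto simp: paths_def unit_deg_degrees)
  with i that show ?thesis
    by blast
qed

lemma edge_fact_mor: "edge_fact \<Lambda> fs \<kappa> \<Longrightarrow> \<kappa> \<in> mor \<Lambda>"
proof (induction fs arbitrary: \<kappa>)
  case Nil
  then show ?case
    by (simp add: verts_mor)
next
  case (Cons f fs)
  then show ?case
    by (auto simp: edges_def intro!: comp_mor dest: pathsD)
qed

text \<open>A nonempty product of edges has nonzero degree.\<close>

lemma edge_fact_vertex:
  assumes "edge_fact \<Lambda> fs v" "v \<in> verts \<Lambda>"
  shows "fs = []"
proof (cases fs)
  case (Cons f gs)
  with assms(1) obtain \<mu> where \<mu>: "f \<in> edges \<Lambda>" "edge_fact \<Lambda> gs \<mu>" "src \<Lambda> f = rng \<Lambda> \<mu>" "v = cmp \<Lambda> f \<mu>"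
    by auto
  obtain i where i: "f \<in> paths \<Lambda> (unit_deg i)"
    using \<mu>(1) by (auto simp: edges_def)
  have "zero_deg = add_deg (unit_deg i) (deg \<Lambda> \<mu>)"
    using \<mu> i deg_comp[of f \<mu>] edge_fact_mor[OF \<mu>(2)] verts_deg[OF assms(2)] by (auto simp: paths_def)
  then have "zero_deg i = add_deg (unit_deg i) (deg \<Lambda> \<mu>) i"
    by simp
  then show ?thesis
    by (simp add: zero_deg_def add_deg_def unit_deg_def)
qed

text \<open>By induction on \<open>|d(\<kappa>)|\<close>: an edge of degree \<open>e\<^sub>i\<close> splits off whenever the \<open>i\<close>-th entry of the
  degree is positive.\<close>

lemma edge_fact_exists: "\<kappa> \<in> mor \<Lambda> \<Longrightarrow> \<exists>fs. edge_fact \<Lambda> fs \<kappa>"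
proof (induction "\<Sum>i<k. deg \<Lambda> \<kappa> i" arbitrary: \<kappa>)
  case 0
  have "deg \<Lambda> \<kappa> i = 0" for i
    using 0 deg_degrees[of \<kappa>] by (cases "i < k") (auto simp: degrees_def)
  then have "\<kappa> \<in> verts \<Lambda>"
    using 0 by (auto simp: verts_def paths_def zero_deg_def)
  then show ?case
    by (intro exI[of _ "[]"]) simp
next
  case (Suc n)
  then obtain i where i: "i < k" "deg \<Lambda> \<kappa> i > 0"
    by (metis gr0I lessThan_iff sum.neutral nat.distinct(1))
  define m where "m = (deg \<Lambda> \<kappa>)(i := deg \<Lambda> \<kappa> i - 1)"
  have m: "deg \<Lambda> \<kappa> = add_deg (unit_deg i) m"
    using i(2) by (auto simp: m_def add_deg_def unit_deg_def)
  have "m \<in> degrees k"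
    using deg_degrees[OF Suc.prems] by (auto simp: m_def degrees_def)
  then obtain f \<mu> where f: "f \<in> paths \<Lambda> (unit_deg i)" "\<mu> \<in> paths \<Lambda> m" "src \<Lambda> f = rng \<Lambda> \<mu>"
      "\<kappa> = cmp \<Lambda> f \<mu>"
    using factorization[OF Suc.prems _ _ m] i(1) unit_deg_degrees by (metis ex1_implies_ex)
  have "(\<Sum>j<k. deg \<Lambda> \<kappa> j) = (\<Sum>j<k. unit_deg i j) + (\<Sum>j<k. m j)"
    unfolding m add_deg_def by (rule sum.distrib)
  also have "(\<Sum>j<k. unit_deg i j) = 1"
    using i(1) by (simp add: unit_deg_def)
  finally have "n = (\<Sum>j<k. deg \<Lambda> \<mu> j)"
    using Suc.hyps(2) f(2) by (simp add: paths_def)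
  from Suc.hyps(1)[OF this pathsD(1)[OF f(2)]] obtain fs where "edge_fact \<Lambda> fs \<mu>"
    by blast
  then have "edge_fact \<Lambda> (f # fs) \<kappa>"
    using f by (auto simp: edges_def)
  then show ?case
    by blast
qed

end

section \<open>Systems presented on edges\<close>

locale k_graph_semibranching =
  k_graph k \<Lambda> + Lambda_semibranching k \<Lambda> M D \<tau> T
  for k :: nat and \<Lambda> :: "'a kgraph" and M :: "'x measure"
    and D :: "'a \<Rightarrow> 'x set" and \<tau> :: "'a \<Rightarrow> 'x \<Rightarrow> 'x" and T :: "(nat \<Rightarrow> nat) \<Rightarrow> 'x \<Rightarrow> 'x"
begin

lemma branch:
  assumes "\<kappa> \<in> mor \<Lambda>"
  shows "nonsingular_branch M (D \<kappa>) (\<tau> \<kappa>) (T (deg \<Lambda> \<kappa>))"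
proof (rule semibranching_branch)
  show "\<kappa> \<in> paths \<Lambda> (deg \<Lambda> \<kappa>)"
    using assms by (simp add: paths_def)
qed (use assms deg_degrees semibranching_paths coding in auto)

text \<open>Compare \<open>\<kappa>\<close> with \<open>\<kappa> s(\<kappa>)\<close>. The range of \<open>\<tau> (s(\<kappa>))\<close> is \<open>D (s(\<kappa>))\<close> and lies almost everywhere in
  \<open>D \<kappa>\<close>; conversely the composite of \<open>\<tau> \<kappa>\<close> and \<open>\<tau> (s(\<kappa>))\<close> has domain \<open>D \<kappa> \<inter> D (s(\<kappa>))\<close>, which has
  to be \<open>D \<kappa>\<close> almost everywhere.\<close>

lemma dom_eq_dom_src:
  assumes "\<kappa> \<in> mor \<Lambda>"
  shows "ae_eq_set M (D \<kappa>) (D (src \<Lambda> \<kappa>))"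
proof -
  let ?v = "src \<Lambda> \<kappa>"
  have v: "?v \<in> mor \<Lambda>" "?v \<in> verts \<Lambda>" "src \<Lambda> \<kappa> = rng \<Lambda> ?v" "cmp \<Lambda> \<kappa> ?v = \<kappa>"
    using assms src_mor src_verts src_ident comp_src by auto
  have "ae_subset M (\<tau> ?v ` D ?v) (D \<kappa>)"
    "ae_eq_set M (comp_dom (D \<kappa>) (D ?v) (\<tau> ?v)) (D \<kappa>)"
    using range_subset[OF assms v(1,3)] map_comp[OF assms v(1,3)] v(4) by (auto simp: ae_eq_map_def)
  moreover have "\<tau> ?v ` D ?v = D ?v" "comp_dom (D \<kappa>) (D ?v) (\<tau> ?v) = D ?v \<inter> D \<kappa>"
    using vertex_map[OF v(2)] by (force, auto simp: comp_dom_def)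
  ultimately have "AE x in M. x \<in> D ?v \<longrightarrow> x \<in> D \<kappa>" "AE x in M. x \<in> D ?v \<inter> D \<kappa> \<longleftrightarrow> x \<in> D \<kappa>"
    unfolding ae_subset_def ae_eq_set_def by simp_all
  then show ?thesis
    unfolding ae_eq_set_def by eventually_elim auto
qed

lemma AE_ranges_cover:
  assumes "m \<in> degrees k"
  shows "AE x in M. \<exists>\<kappa>\<in>paths \<Lambda> m. x \<in> \<tau> \<kappa> ` D \<kappa>"
proof -
  interpret semibranching M "paths \<Lambda> m" D \<tau>
    using assms by (rule semibranching_paths)
  let ?S = "space M - (\<Union>\<kappa>\<in>paths \<Lambda> m. \<tau> \<kappa> ` D \<kappa>)"
  have "?S \<in> sets M"
    using image_sets[OF _ dom_sets] finite_index by auto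
  then have "AE x in M. x \<notin> ?S"
    using ranges_cover by (simp only: emeasure_eq_0_iff_AE)
  then show ?thesis
    using AE_space by eventually_elim auto
qed

lemma AE_ranges_disjoint:
  assumes "\<kappa> \<in> paths \<Lambda> m" "\<nu> \<in> paths \<Lambda> m" "\<kappa> \<noteq> \<nu>"
  shows "AE x in M. \<not> (x \<in> \<tau> \<kappa> ` D \<kappa> \<and> x \<in> \<tau> \<nu> ` D \<nu>)"
proof -
  interpret semibranching M "paths \<Lambda> m" D \<tau>
    using assms(1) deg_degrees by (intro semibranching_paths) (auto simp: paths_def)
  have "\<tau> \<kappa> ` D \<kappa> \<inter> \<tau> \<nu> ` D \<nu> \<in> sets M"
    using assms image_sets[OF _ dom_sets] by auto
  then have "AE x in M. x \<notin> \<tau> \<kappa> ` D \<kappa> \<inter> \<tau> \<nu> ` D \<nu>"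
    using ranges_disjoint[OF assms] by (simp only: emeasure_eq_0_iff_AE)
  then show ?thesis
    by eventually_elim auto
qed

lemma vertex_range: "v \<in> verts \<Lambda> \<Longrightarrow> \<tau> v ` D v = D v"
  using vertex_map by force

text \<open>The domains of the vertices are their own ranges, and ranges of one degree are disjoint.\<close>

lemma vertex_doms_disjoint:
  assumes "u \<in> verts \<Lambda>" "v \<in> verts \<Lambda>" "u \<noteq> v"
  shows "AE x in M. \<not> (x \<in> D u \<and> x \<in> D v)"
  using AE_ranges_disjoint[of u zero_deg v] assms vertex_range by (simp add: verts_def)

end

text \<open>All edges of degree \<open>e\<^sub>i\<close> have \<open>Te i\<close> as an exact left inverse, not just up to null sets. The same
  then holds for composites of edges and products of the \<open>Te i\<close>, as a coding map requires.\<close>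

locale edge_presentation =
  k_graph_semibranching k \<Lambda> M D \<tau> T + sigma_finite_measure M
  for k :: nat and \<Lambda> :: "'a kgraph" and M :: "'x measure"
    and D :: "'a \<Rightarrow> 'x set" and \<tau> :: "'a \<Rightarrow> 'x \<Rightarrow> 'x" and T :: "(nat \<Rightarrow> nat) \<Rightarrow> 'x \<Rightarrow> 'x" +
  fixes De :: "'a \<Rightarrow> 'x set" and \<tau>e :: "'a \<Rightarrow> 'x \<Rightarrow> 'x" and Te :: "nat \<Rightarrow> 'x \<Rightarrow> 'x"
  assumes edge_branch: "\<lbrakk>i < k; f \<in> paths \<Lambda> (unit_deg i)\<rbrakk> \<Longrightarrow> nonsingular_branch M (De f) (\<tau>e f) (Te i)"
    and edge_ae: "f \<in> edges \<Lambda> \<Longrightarrow> ae_eq_map M (De f) (\<tau>e f) (D f) (\<tau> f)"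
    and Te_measurable: "i < k \<Longrightarrow> Te i \<in> measurable M M"
    and Te_commute: "\<lbrakk>i < k; j < k; x \<in> space M\<rbrakk> \<Longrightarrow> Te i (Te j x) = Te j (Te i x)"
begin

lemma edge_range:
  assumes "i < k" "f \<in> paths \<Lambda> (unit_deg i)"
  shows "ae_eq_set M (\<tau>e f ` De f) (\<tau> f ` D f)"
  using edge_branch[OF assms] branch[OF pathsD(1)[OF assms(2)]] edge_ae assms(2)
  by (intro ae_eq_map_range) (auto simp: edges_def)

lemma satisfies_edge_conditions: "edge_conditions k \<Lambda> M D De \<tau>e Te"
proof
  have i: "ae_eq_set M (De f) (D (src \<Lambda> f))" if "f \<in> edges \<Lambda>" for f
    using ae_eq_map_dom[OF edge_ae[OF that]] dom_eq_dom_src that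
    by (auto simp: edges_def dest: pathsD intro: ae_eq_set_trans)
  show "ae_eq_set M (De f) (De g) \<and> ae_eq_set M (De f) (D u)"
    if "f \<in> edges \<Lambda>" "g \<in> edges \<Lambda>" "src \<Lambda> f = u" "src \<Lambda> g = u" for f g u
    using i[OF that(1)] i[OF that(2)] that(3,4) by (auto intro: ae_eq_set_trans ae_eq_set_sym)
  show "emeasure M (D u) > 0" if "u \<in> verts \<Lambda>" for u
    using that by (rule vertex_pos)
  have vsets: "D u \<in> sets M" if "u \<in> verts \<Lambda>" for u
    using branch[OF verts_mor[OF that]] by (rule nonsingular_branch.dom_sets)
  show "emeasure M (D u \<inter> D v) = 0" if "u \<in> verts \<Lambda>" "v \<in> verts \<Lambda>" "u \<noteq> v" for u v
    using vertex_doms_disjoint[OF that] vsets that by (subst emeasure_eq_0_iff_AE) auto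
  show "Te i (Te j x) = Te j (Te i x)" if "i < k" "j < k" "x \<in> space M" for i j x
    using that by (rule Te_commute)
  \<comment> \<open>Condition (iii): both composites agree almost everywhere with the given prefixing map of the
    common product \<open>f \<alpha> = g \<beta>\<close>.\<close>
  have two: "ae_subset M (\<tau>e \<alpha> ` De \<alpha>) (De f)"
      "ae_eq_map M (comp_dom (De f) (De \<alpha>) (\<tau>e \<alpha>)) (\<tau>e f \<circ> \<tau>e \<alpha>) (D (cmp \<Lambda> f \<alpha>)) (\<tau> (cmp \<Lambda> f \<alpha>))"
    if f: "i < k" "f \<in> paths \<Lambda> (unit_deg i)" and \<alpha>: "j < k" "\<alpha> \<in> paths \<Lambda> (unit_deg j)"
      and s: "src \<Lambda> f = rng \<Lambda> \<alpha>" for f \<alpha> i j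
  proof -
    have e: "f \<in> edges \<Lambda>" "\<alpha> \<in> edges \<Lambda>"
      using f \<alpha> by (auto simp: edges_def)
    show "ae_subset M (\<tau>e \<alpha> ` De \<alpha>) (De f)"
      using edge_range[OF \<alpha>] ae_eq_map_dom[OF edge_ae[OF e(1)]]
        range_subset[OF pathsD(1)[OF f(2)] pathsD(1)[OF \<alpha>(2)] s]
      by (rule ae_subset_cong)
    show "ae_eq_map M (comp_dom (De f) (De \<alpha>) (\<tau>e \<alpha>)) (\<tau>e f \<circ> \<tau>e \<alpha>) (D (cmp \<Lambda> f \<alpha>)) (\<tau> (cmp \<Lambda> f \<alpha>))"
      using ae_eq_map_comp[OF edge_branch[OF \<alpha>] edge_ae[OF e(1)] edge_ae[OF e(2)]]
        map_comp[OF pathsD(1)[OF f(2)] pathsD(1)[OF \<alpha>(2)] s]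
      by (rule ae_eq_map_trans)
  qed
  show "ae_subset M (\<tau>e \<alpha> ` De \<alpha>) (De f) \<and> ae_subset M (\<tau>e \<beta> ` De \<beta>) (De g) \<and>
        ae_eq_map M (comp_dom (De f) (De \<alpha>) (\<tau>e \<alpha>)) (\<tau>e f \<circ> \<tau>e \<alpha>)
                    (comp_dom (De g) (De \<beta>) (\<tau>e \<beta>)) (\<tau>e g \<circ> \<tau>e \<beta>)"
    if "i < k" "j < k" "f \<in> paths \<Lambda> (unit_deg i)" "\<beta> \<in> paths \<Lambda> (unit_deg i)"
      "g \<in> paths \<Lambda> (unit_deg j)" "\<alpha> \<in> paths \<Lambda> (unit_deg j)"
      "src \<Lambda> f = rng \<Lambda> \<alpha>" "src \<Lambda> g = rng \<Lambda> \<beta>" "cmp \<Lambda> f \<alpha> = cmp \<Lambda> g \<beta>" for i j f g \<alpha> \<beta>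
    using two[of i f j \<alpha>] two[of j g i \<beta>] that by (auto intro: ae_eq_map_trans ae_eq_map_sym)
  show "emeasure M (D u - (\<Union>g\<in>{g \<in> paths \<Lambda> (unit_deg i). rng \<Lambda> g = u}. \<tau>e g ` De g)) = 0"
    if u: "u \<in> verts \<Lambda>" and i: "i < k" for u i
  proof -
    \<comment> \<open>Almost every point of \<open>D u\<close> lies in the range of some edge \<open>g\<close> of degree \<open>e\<^sub>i\<close>. That range is
      contained in \<open>D (r(g))\<close>, which meets \<open>D u\<close> in a null set unless \<open>r(g) = u\<close>.\<close>
    let ?P = "paths \<Lambda> (unit_deg i)"
    have m: "unit_deg i \<in> degrees k"
      using i by (simp add: unit_deg_degrees)
    have fin: "finite ?P"
      using semibranching_paths[OF m] by (rule semibranching.finite_index)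
    have "AE x in M. x \<in> \<tau> g ` D g \<and> x \<in> D u \<longrightarrow> rng \<Lambda> g = u \<and> x \<in> \<tau>e g ` De g" if g: "g \<in> ?P" for g
    proof -
      have gm: "g \<in> mor \<Lambda>" "rng \<Lambda> g \<in> verts \<Lambda>"
        using g rng_verts by (auto simp: paths_def)
      have "ae_subset M (\<tau> g ` D g) (D (rng \<Lambda> g))"
        using gm rng_ident by (intro range_subset) (auto simp: verts_mor)
      moreover have "AE x in M. rng \<Lambda> g \<noteq> u \<longrightarrow> \<not> (x \<in> D (rng \<Lambda> g) \<and> x \<in> D u)"
        using vertex_doms_disjoint[OF gm(2) u] by (cases "rng \<Lambda> g = u") auto
      ultimately show ?thesis
        using edge_range[OF i g] unfolding ae_subset_def ae_eq_set_def by eventually_elim blast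
    qed
    then have "AE x in M. \<forall>g\<in>?P. x \<in> \<tau> g ` D g \<and> x \<in> D u \<longrightarrow> rng \<Lambda> g = u \<and> x \<in> \<tau>e g ` De g"
      by (intro AE_finite_allI[OF fin])
    with AE_ranges_cover[OF m]
    have "AE x in M. x \<notin> D u - (\<Union>g\<in>{g \<in> ?P. rng \<Lambda> g = u}. \<tau>e g ` De g)"
      by eventually_elim blast
    moreover have "D u - (\<Union>g\<in>{g \<in> ?P. rng \<Lambda> g = u}. \<tau>e g ` De g) \<in> sets M"
      using fin vsets[OF u] nonsingular_branch.range_sets[OF edge_branch[OF i]]
      by (intro sets.Diff sets.finite_UN) auto
    ultimately show ?thesis
      by (simp only: emeasure_eq_0_iff_AE)
  qed
qed

subsection \<open>Powers of the coding maps\<close>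

text \<open>
  The given \<open>T m\<close> cannot stand in for the powers of the maps \<open>Te i\<close>. For instance \<open>T zero_deg\<close> inverts
  the vertex maps only on their domains and may differ from the identity elsewhere, whereas an empty
  product of coding maps is the identity everywhere. Additivity in the degree is therefore derived
  from the commutation of the maps \<open>Te i\<close> alone.

  In \<open>ordered_power\<close> the list \<open>[0..<k]\<close> becomes a variable, for induction.
\<close>

definition ordered_power :: "(nat \<Rightarrow> nat) \<Rightarrow> nat list \<Rightarrow> 'x \<Rightarrow> 'x" where
  "ordered_power m xs = foldr (\<lambda>i h. (Te i ^^ m i) \<circ> h) xs id"

lemma ordered_power_simps [simp]:
  "ordered_power m [] x = x"
  "ordered_power m (i # xs) x = (Te i ^^ m i) (ordered_power m xs x)"
  by (simp_all add: ordered_power_def)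

lemma coding_power_eq_ordered_power: "coding_power k Te m = ordered_power m [0..<k]"
  by (simp add: coding_power_def ordered_power_def)

lemma funpow_Te:
  assumes "i < k" "j < k" "x \<in> space M"
  shows "(Te i ^^ n) x \<in> space M" "(Te i ^^ n) (Te j x) = Te j ((Te i ^^ n) x)"
proof -
  have "(Te i ^^ n) x \<in> space M \<and> (Te i ^^ n) (Te j x) = Te j ((Te i ^^ n) x)"
    using assms Te_commute Te_measurable[THEN measurable_space] by (induction n) auto
  then show "(Te i ^^ n) x \<in> space M" "(Te i ^^ n) (Te j x) = Te j ((Te i ^^ n) x)"
    by auto
qed

lemma funpow_Te_commute:
  assumes "i < k" "j < k" "x \<in> space M"
  shows "(Te i ^^ n) ((Te j ^^ l) x) = (Te j ^^ l) ((Te i ^^ n) x)"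
  using assms funpow_Te by (induction l) auto

lemma ordered_power_space:
  "set xs \<subseteq> {..<k} \<Longrightarrow> x \<in> space M \<Longrightarrow> ordered_power m xs x \<in> space M"
  by (induction xs) (auto intro: funpow_Te)

lemma ordered_power_commute:
  assumes "set xs \<subseteq> {..<k}" "j < k" "x \<in> space M"
  shows "ordered_power m xs ((Te j ^^ l) x) = (Te j ^^ l) (ordered_power m xs x)"
  using assms(1)
proof (induction xs)
  case (Cons i xs)
  then show ?case
    using funpow_Te_commute[of i j "ordered_power m xs x"] ordered_power_space[of xs x m] assms(2,3)
    by simp
qed simp

lemma coding_power_add:
  assumes "x \<in> space M"
  shows "coding_power k Te (add_deg m n) x = coding_power k Te m (coding_power k Te n x)"
proof -
  have "ordered_power (add_deg m n) xs x = ordered_power m xs (ordered_power n xs x)"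
    if "set xs \<subseteq> {..<k}" for xs
    using that
  proof (induction xs)
    case (Cons i xs)
    then show ?case
      using ordered_power_commute[of xs i "ordered_power n xs x" m "n i"]
        ordered_power_space[of xs x n] assms
      by (simp add: add_deg_def funpow_add)
  qed simp
  from this[of "[0..<k]"] show ?thesis
    by (simp add: coding_power_eq_ordered_power lessThan_atLeast0)
qed

lemma coding_power_zero: "coding_power k Te zero_deg = id"
proof -
  have "ordered_power zero_deg xs x = x" for xs x
    by (induction xs) (auto simp: zero_deg_def)
  then show ?thesis
    by (simp add: coding_power_eq_ordered_power fun_eq_iff)
qed

lemma coding_power_unit:
  assumes "i < k"
  shows "coding_power k Te (unit_deg i) = Te i"
proof -
  have "ordered_power (unit_deg i) xs x = (if i \<in> set xs then Te i x else x)" if "distinct xs" for xs x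
    using that by (induction xs) (auto simp: unit_deg_def)
  then show ?thesis
    using assms by (simp add: coding_power_eq_ordered_power fun_eq_iff)
qed

lemma coding_power_measurable: "coding_power k Te m \<in> measurable M M"
proof -
  have pow: "(\<lambda>x. (Te i ^^ n) (h x)) \<in> measurable M M" if "i < k" "h \<in> measurable M M" for i n h
    using that(2) by (induction n) (auto intro: measurable_compose[OF _ Te_measurable[OF that(1)]])
  have "ordered_power m xs \<in> measurable M M" if "set xs \<subseteq> {..<k}" for xs
    using that
  proof (induction xs)
    case Nil
    then show ?case
      by (simp add: ordered_power_def)
  next
    case (Cons i xs)
    then show ?case
      using pow[of i "ordered_power m xs" "m i"] by (simp add: ordered_power_def comp_def)
  qed
  from this[of "[0..<k]"] show ?thesis
    by (simp add: coding_power_eq_ordered_power lessThan_atLeast0)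
qed

subsection \<open>The system of composites along factorizations\<close>

text \<open>Induction along the factorization. The first conclusion collects what has to hold exactly, the
  second says that the composite does not depend, up to null sets, on the factorization.\<close>

lemma edge_fact_branch:
  assumes "edge_fact \<Lambda> fs \<kappa>"
  shows "nonsingular_branch M (path_dom (D (src \<Lambda> \<kappa>)) De \<tau>e fs) (path_map \<tau>e fs)
             (coding_power k Te (deg \<Lambda> \<kappa>))
       \<and> ae_eq_map M (path_dom (D (src \<Lambda> \<kappa>)) De \<tau>e fs) (path_map \<tau>e fs) (D \<kappa>) (\<tau> \<kappa>)"
  using assms
proof (induction fs arbitrary: \<kappa>)
  case Nil
  then have v: "\<kappa> \<in> verts \<Lambda>"
    by simp
  interpret nonsingular_branch M "D \<kappa>" "\<tau> \<kappa>" "T (deg \<Lambda> \<kappa>)"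
    using v by (intro branch verts_mor)
  have "nonsingular_branch M (D \<kappa>) id id"
    using dom_sets vertex_map[OF v] by (intro restrict) auto
  then show ?case
    using v vertex_map[OF v]
    by (auto simp: vertex_identity verts_deg coding_power_zero ae_eq_map_iff simp flip: id_def)
next
  case (Cons f fs)
  then obtain \<mu> where f: "f \<in> edges \<Lambda>" and \<mu>: "edge_fact \<Lambda> fs \<mu>"
      and s: "src \<Lambda> f = rng \<Lambda> \<mu>" and \<kappa>: "\<kappa> = cmp \<Lambda> f \<mu>"
    by auto
  obtain i where i: "i < k" "f \<in> paths \<Lambda> (unit_deg i)"
    using f by (rule edge_degree)
  have mor: "f \<in> mor \<Lambda>" "\<mu> \<in> mor \<Lambda>"
    using i(2) \<mu> by (auto simp: edge_fact_mor dest: pathsD)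
  have src: "src \<Lambda> \<kappa> = src \<Lambda> \<mu>" and deg: "deg \<Lambda> \<kappa> = add_deg (deg \<Lambda> \<mu>) (unit_deg i)"
    using src_comp[OF mor s] deg_comp[OF mor s] pathsD(2)[OF i(2)] \<kappa> by (auto simp: add_deg_commute)
  let ?A = "path_dom (D (src \<Lambda> \<mu>)) De \<tau>e fs" and ?h = "path_map \<tau>e fs"
  let ?B = "comp_dom (De f) ?A ?h"
  from Cons.IH[OF \<mu>] have br: "nonsingular_branch M ?A ?h (coding_power k Te (deg \<Lambda> \<mu>))"
      and ae: "ae_eq_map M ?A ?h (D \<mu>) (\<tau> \<mu>)"
    by auto
  interpret nonsingular_branch M ?B "\<tau>e f \<circ> ?h" "coding_power k Te (deg \<Lambda> \<mu>) \<circ> Te i"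
    using edge_branch[OF i] br by (rule nonsingular_branch_comp)
  have "nonsingular_branch M ?B (\<tau>e f \<circ> ?h) (coding_power k Te (deg \<Lambda> \<kappa>))"
  proof (rule restrict)
    show "coding_power k Te (deg \<Lambda> \<kappa>) ((\<tau>e f \<circ> ?h) x) = x" if "x \<in> ?B" for x
      \<comment> \<open>The edge comes first in the path, so its coding map has to be applied first.\<close>
      using left_inverse[OF that] map_space[OF that] i(1)
      by (simp add: deg coding_power_add coding_power_unit)
  qed (use dom_sets coding_power_measurable in auto)
  moreover have "ae_eq_map M ?B (\<tau>e f \<circ> ?h) (D \<kappa>) (\<tau> \<kappa>)"
    unfolding \<kappa> using ae_eq_map_comp[OF br edge_ae[OF f] ae] map_comp[OF mor s]
    by (rule ae_eq_map_trans)
  ultimately show ?case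
    by (simp add: src o_def)
qed

theorem path_system:
  assumes F: "\<forall>\<kappa>\<in>mor \<Lambda>. edge_fact \<Lambda> (F \<kappa>) \<kappa>"
  shows "Lambda_semibranching k \<Lambda> M (\<lambda>\<kappa>. path_dom (D (src \<Lambda> \<kappa>)) De \<tau>e (F \<kappa>))
           (\<lambda>\<kappa>. path_map \<tau>e (F \<kappa>)) (coding_power k Te)"
    (is "Lambda_semibranching k \<Lambda> M ?E ?\<sigma> ?S")
proof (rule Lambda_semibranching.intro)
  have br: "nonsingular_branch M (?E \<kappa>) (?\<sigma> \<kappa>) (?S (deg \<Lambda> \<kappa>))"
    and ae: "ae_eq_map M (?E \<kappa>) (?\<sigma> \<kappa>) (D \<kappa>) (\<tau> \<kappa>)" if "\<kappa> \<in> mor \<Lambda>" for \<kappa>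
    using edge_fact_branch F that by auto
  have ran: "ae_eq_set M (?\<sigma> \<kappa> ` ?E \<kappa>) (\<tau> \<kappa> ` D \<kappa>)" if "\<kappa> \<in> mor \<Lambda>" for \<kappa>
    using br[OF that] branch[OF that] ae[OF that] by (rule ae_eq_map_range)
  show "semibranching M (paths \<Lambda> m) ?E ?\<sigma>" if m: "m \<in> degrees k" for m
  proof (rule semibranchingI)
    show "sigma_finite_measure M"
      by unfold_locales
    show fin: "finite (paths \<Lambda> m)"
      using semibranching_paths[OF m] by (rule semibranching.finite_index)
    show "nonsingular_branch M (?E \<kappa>) (?\<sigma> \<kappa>) (?S m)" if "\<kappa> \<in> paths \<Lambda> m" for \<kappa>
      using br that by (auto simp: paths_def)
    have "AE x in M. \<forall>\<kappa>\<in>paths \<Lambda> m. x \<in> ?\<sigma> \<kappa> ` ?E \<kappa> \<longleftrightarrow> x \<in> \<tau> \<kappa> ` D \<kappa>"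
      using ran by (intro AE_finite_allI[OF fin]) (auto simp: ae_eq_set_def paths_def)
    with AE_ranges_cover[OF m] show "AE x in M. \<exists>\<kappa>\<in>paths \<Lambda> m. x \<in> ?\<sigma> \<kappa> ` ?E \<kappa>"
      by eventually_elim blast
    show "AE x in M. \<not> (x \<in> ?\<sigma> \<kappa> ` ?E \<kappa> \<and> x \<in> ?\<sigma> \<nu> ` ?E \<nu>)"
      if "\<kappa> \<in> paths \<Lambda> m" "\<nu> \<in> paths \<Lambda> m" "\<kappa> \<noteq> \<nu>" for \<kappa> \<nu>
      using AE_ranges_disjoint[OF that] ran[OF pathsD(1)[OF that(1)]] ran[OF pathsD(1)[OF that(2)]]
      unfolding ae_eq_set_def by eventually_elim blast
  qed
  show "coding_map M (paths \<Lambda> m) ?E ?\<sigma> (?S m)" for m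
    unfolding coding_map_def
    using coding_power_measurable nonsingular_branch.left_inverse[OF br] by (auto simp: paths_def)
  have vertex: "F v = []" if "v \<in> verts \<Lambda>" for v
    using F that by (intro edge_fact_vertex[of _ v]) (auto simp: verts_mor)
  show "?\<sigma> v x = x" if "v \<in> verts \<Lambda>" for v x
    using vertex[OF that] by simp
  show "emeasure M (?E v) > 0" if "v \<in> verts \<Lambda>" for v
    using vertex[OF that] vertex_pos[OF that] that by (simp add: vertex_identity)
  fix \<kappa> \<nu> assume mor: "\<kappa> \<in> mor \<Lambda>" "\<nu> \<in> mor \<Lambda>" and s: "src \<Lambda> \<kappa> = rng \<Lambda> \<nu>"
  show "ae_subset M (?\<sigma> \<nu> ` ?E \<nu>) (?E \<kappa>)"
    using ran[OF mor(2)] ae_eq_map_dom[OF ae[OF mor(1)]] range_subset[OF mor s] by (rule ae_subset_cong)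
  have "ae_eq_map M (comp_dom (?E \<kappa>) (?E \<nu>) (?\<sigma> \<nu>)) (?\<sigma> \<kappa> \<circ> ?\<sigma> \<nu>)
          (comp_dom (D \<kappa>) (D \<nu>) (\<tau> \<nu>)) (\<tau> \<kappa> \<circ> \<tau> \<nu>)"
    using br[OF mor(2)] ae[OF mor(1)] ae[OF mor(2)] by (rule ae_eq_map_comp)
  from ae_eq_map_trans[OF this map_comp[OF mor s]] ae_eq_map_sym[OF ae[OF comp_mor[OF mor s]]]
  show "ae_eq_map M (comp_dom (?E \<kappa>) (?E \<nu>) (?\<sigma> \<nu>)) (?\<sigma> \<kappa> \<circ> ?\<sigma> \<nu>)
          (?E (cmp \<Lambda> \<kappa> \<nu>)) (?\<sigma> (cmp \<Lambda> \<kappa> \<nu>))"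
    by (rule ae_eq_map_trans)
next
  show "coding_power k Te m (coding_power k Te n x) = coding_power k Te (add_deg m n) x"
    if "x \<in> space M" for m n x
    using coding_power_add[OF that] by simp
qed

end

section \<open>Products\<close>

definition fst_deg :: "nat \<Rightarrow> (nat \<Rightarrow> nat) \<Rightarrow> (nat \<Rightarrow> nat)" where
  "fst_deg k1 m = (\<lambda>i. if i < k1 then m i else 0)"

definition snd_deg :: "nat \<Rightarrow> (nat \<Rightarrow> nat) \<Rightarrow> (nat \<Rightarrow> nat)" where
  "snd_deg k1 m = (\<lambda>i. m (i + k1))"

definition pair_deg :: "nat \<Rightarrow> (nat \<Rightarrow> nat) \<Rightarrow> (nat \<Rightarrow> nat) \<Rightarrow> (nat \<Rightarrow> nat)" where
  "pair_deg k1 a b = (\<lambda>i. if i < k1 then a i else b (i - k1))"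

lemma pair_deg_eq_iff:
  assumes "a \<in> degrees k1"
  shows "pair_deg k1 a b = m \<longleftrightarrow> a = fst_deg k1 m \<and> b = snd_deg k1 m"
proof
  have "a = fst_deg k1 (pair_deg k1 a b)" "b = snd_deg k1 (pair_deg k1 a b)"
    using assms by (auto simp: fun_eq_iff degrees_def pair_deg_def fst_deg_def snd_deg_def)
  then show "a = fst_deg k1 m \<and> b = snd_deg k1 m" if "pair_deg k1 a b = m"
    using that by simp
  show "pair_deg k1 a b = m" if "a = fst_deg k1 m \<and> b = snd_deg k1 m"
    using that by (simp add: fun_eq_iff pair_deg_def fst_deg_def snd_deg_def)
qed

lemma pair_deg_degrees: "b \<in> degrees k2 \<Longrightarrow> pair_deg k1 a b \<in> degrees (k1 + k2)"
  by (auto simp: degrees_def pair_deg_def)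

lemma fst_deg_degrees: "fst_deg k1 m \<in> degrees k1"
  and snd_deg_degrees: "m \<in> degrees (k1 + k2) \<Longrightarrow> snd_deg k1 m \<in> degrees k2"
  by (auto simp: degrees_def fst_deg_def snd_deg_def)

lemma fst_deg_add: "fst_deg k1 (add_deg m n) = add_deg (fst_deg k1 m) (fst_deg k1 n)"
  and snd_deg_add: "snd_deg k1 (add_deg m n) = add_deg (snd_deg k1 m) (snd_deg k1 n)"
  by (auto simp: add_deg_def fst_deg_def snd_deg_def)

lemma fst_deg_zero: "fst_deg k1 zero_deg = zero_deg"
  and snd_deg_zero: "snd_deg k1 zero_deg = zero_deg"
  by (auto simp: zero_deg_def fst_deg_def snd_deg_def)

lemma pair_deg_zero: "pair_deg k1 zero_deg zero_deg = zero_deg"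
  by (auto simp: zero_deg_def pair_deg_def)

lemma pair_deg_add: "pair_deg k1 (add_deg a a') (add_deg b b') = add_deg (pair_deg k1 a b) (pair_deg k1 a' b')"
  by (auto simp: add_deg_def pair_deg_def)

lemma fst_deg_unit: "fst_deg k1 (unit_deg i) = (if i < k1 then unit_deg i else zero_deg)"
  and snd_deg_unit: "snd_deg k1 (unit_deg i) = (if i < k1 then zero_deg else unit_deg (i - k1))"
  by (auto simp: fun_eq_iff unit_deg_def zero_deg_def fst_deg_def snd_deg_def)

lemma prod_kgraph_simps:
  "mor (prod_kgraph k1 \<Lambda>1 \<Lambda>2) = mor \<Lambda>1 \<times> mor \<Lambda>2"
  "rng (prod_kgraph k1 \<Lambda>1 \<Lambda>2) p = (rng \<Lambda>1 (fst p), rng \<Lambda>2 (snd p))"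
  "src (prod_kgraph k1 \<Lambda>1 \<Lambda>2) p = (src \<Lambda>1 (fst p), src \<Lambda>2 (snd p))"
  "cmp (prod_kgraph k1 \<Lambda>1 \<Lambda>2) p q = (cmp \<Lambda>1 (fst p) (fst q), cmp \<Lambda>2 (snd p) (snd q))"
  "deg (prod_kgraph k1 \<Lambda>1 \<Lambda>2) p = pair_deg k1 (deg \<Lambda>1 (fst p)) (deg \<Lambda>2 (snd p))"
  by (auto simp: prod_kgraph_def pair_deg_def map_prod_def case_prod_unfold)

locale k_graph_pair = G1: k_graph k1 \<Lambda>1 + G2: k_graph k2 \<Lambda>2
  for k1 k2 :: nat and \<Lambda>1 :: "'a kgraph" and \<Lambda>2 :: "'b kgraph"
begin

abbreviation "\<Lambda> \<equiv> prod_kgraph k1 \<Lambda>1 \<Lambda>2"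

lemma paths_prod: "paths \<Lambda> m = paths \<Lambda>1 (fst_deg k1 m) \<times> paths \<Lambda>2 (snd_deg k1 m)"
proof -
  have "p \<in> paths \<Lambda> m \<longleftrightarrow> p \<in> paths \<Lambda>1 (fst_deg k1 m) \<times> paths \<Lambda>2 (snd_deg k1 m)" for p
  proof (cases "fst p \<in> mor \<Lambda>1")
    case True
    then show ?thesis
      using pair_deg_eq_iff[OF G1.deg_degrees[OF True], of "deg \<Lambda>2 (snd p)" m]
      by (simp add: paths_def prod_kgraph_simps mem_Times_iff) blast
  qed (simp add: paths_def prod_kgraph_simps mem_Times_iff)
  then show ?thesis
    by blast
qed

lemma verts_prod: "verts \<Lambda> = verts \<Lambda>1 \<times> verts \<Lambda>2"
  by (simp add: verts_def paths_prod fst_deg_zero snd_deg_zero)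

lemma product_factorization:
  assumes "p \<in> mor \<Lambda>" "m \<in> degrees (k1 + k2)" "n \<in> degrees (k1 + k2)" "deg \<Lambda> p = add_deg m n"
  shows "\<exists>!q. fst q \<in> paths \<Lambda> m \<and> snd q \<in> paths \<Lambda> n \<and> src \<Lambda> (fst q) = rng \<Lambda> (snd q)
            \<and> p = cmp \<Lambda> (fst q) (snd q)"
proof -
  let ?fac1 = "\<lambda>\<mu> \<nu>. \<mu> \<in> paths \<Lambda>1 (fst_deg k1 m) \<and> \<nu> \<in> paths \<Lambda>1 (fst_deg k1 n) \<and> src \<Lambda>1 \<mu> = rng \<Lambda>1 \<nu>
    \<and> fst p = cmp \<Lambda>1 \<mu> \<nu>"
  let ?fac2 = "\<lambda>\<mu> \<nu>. \<mu> \<in> paths \<Lambda>2 (snd_deg k1 m) \<and> \<nu> \<in> paths \<Lambda>2 (snd_deg k1 n) \<and> src \<Lambda>2 \<mu> = rng \<Lambda>2 \<nu>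
    \<and> snd p = cmp \<Lambda>2 \<mu> \<nu>"
  have p: "fst p \<in> mor \<Lambda>1" "snd p \<in> mor \<Lambda>2"
    using assms(1) by (auto simp: prod_kgraph_simps)
  have d: "deg \<Lambda>1 (fst p) = add_deg (fst_deg k1 m) (fst_deg k1 n)"
    "deg \<Lambda>2 (snd p) = add_deg (snd_deg k1 m) (snd_deg k1 n)"
    using assms(4) G1.deg_degrees[OF p(1)]
    by (simp_all add: prod_kgraph_simps pair_deg_eq_iff fst_deg_add snd_deg_add)
  have "\<exists>!q. ?fac1 (fst q) (snd q)"
    using p(1) fst_deg_degrees fst_deg_degrees d(1) by (rule G1.factorization)
  then obtain q1 where q1: "?fac1 (fst q1) (snd q1)" "\<And>q. ?fac1 (fst q) (snd q) \<Longrightarrow> q = q1"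
    by blast
  have "\<exists>!q. ?fac2 (fst q) (snd q)"
    using p(2) snd_deg_degrees[OF assms(2)] snd_deg_degrees[OF assms(3)] d(2) by (rule G2.factorization)
  then obtain q2 where q2: "?fac2 (fst q2) (snd q2)" "\<And>q. ?fac2 (fst q) (snd q) \<Longrightarrow> q = q2"
    by blast
  show ?thesis
  proof (rule ex1I)
    let ?q = "((fst q1, fst q2), (snd q1, snd q2))"
    show "fst ?q \<in> paths \<Lambda> m \<and> snd ?q \<in> paths \<Lambda> n \<and> src \<Lambda> (fst ?q) = rng \<Lambda> (snd ?q)
        \<and> p = cmp \<Lambda> (fst ?q) (snd ?q)"
      using q1(1) q2(1) by (simp add: paths_prod prod_kgraph_simps prod_eq_iff)
    fix q assume q: "fst q \<in> paths \<Lambda> m \<and> snd q \<in> paths \<Lambda> n \<and> src \<Lambda> (fst q) = rng \<Lambda> (snd q)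
        \<and> p = cmp \<Lambda> (fst q) (snd q)"
    have "(fst (fst q), fst (snd q)) = q1"
      using q by (intro q1(2)) (auto simp: paths_prod prod_kgraph_simps)
    moreover have "(snd (fst q), snd (snd q)) = q2"
      using q by (intro q2(2)) (auto simp: paths_prod prod_kgraph_simps)
    ultimately show "q = ?q"
      by (auto simp: prod_eq_iff)
  qed
qed

lemma k_graph_product: "k_graph (k1 + k2) \<Lambda>"
proof (rule k_graph.intro)
  show "countable (mor \<Lambda>)"
    using G1.countable_mor G2.countable_mor by (simp add: prod_kgraph_simps)
  show "\<exists>!q. fst q \<in> paths \<Lambda> m \<and> snd q \<in> paths \<Lambda> n \<and> src \<Lambda> (fst q) = rng \<Lambda> (snd q)
            \<and> p = cmp \<Lambda> (fst q) (snd q)"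
    if "p \<in> mor \<Lambda>" "m \<in> degrees (k1 + k2)" "n \<in> degrees (k1 + k2)" "deg \<Lambda> p = add_deg m n"
    for p m n
    using that by (rule product_factorization)
  show "deg \<Lambda> p \<in> degrees (k1 + k2)" if "p \<in> mor \<Lambda>" for p
    using that G2.deg_degrees[of "snd p"] by (simp add: prod_kgraph_simps mem_Times_iff pair_deg_degrees)
  show "deg \<Lambda> (rng \<Lambda> p) = zero_deg \<and> deg \<Lambda> (src \<Lambda> p) = zero_deg" if "p \<in> mor \<Lambda>" for p
    using that G1.deg_ident[of "fst p"] G2.deg_ident[of "snd p"]
    by (simp add: prod_kgraph_simps mem_Times_iff pair_deg_zero)
  fix p assume "p \<in> mor \<Lambda>"
  then have p: "fst p \<in> mor \<Lambda>1" "snd p \<in> mor \<Lambda>2"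
    by (auto simp: prod_kgraph_simps)
  show "rng \<Lambda> p \<in> mor \<Lambda>" "src \<Lambda> p \<in> mor \<Lambda>"
    "rng \<Lambda> (rng \<Lambda> p) = rng \<Lambda> p \<and> src \<Lambda> (rng \<Lambda> p) = rng \<Lambda> p"
    "rng \<Lambda> (src \<Lambda> p) = src \<Lambda> p \<and> src \<Lambda> (src \<Lambda> p) = src \<Lambda> p"
    "cmp \<Lambda> (rng \<Lambda> p) p = p" "cmp \<Lambda> p (src \<Lambda> p) = p"
    using p G1.rng_mor G2.rng_mor G1.src_mor G2.src_mor G1.rng_ident G2.rng_ident
      G1.src_ident G2.src_ident G1.comp_rng G2.comp_rng G1.comp_src G2.comp_src
    by (simp_all add: prod_kgraph_simps)
  fix q assume "q \<in> mor \<Lambda>" and "src \<Lambda> p = rng \<Lambda> q"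
  then have q: "fst q \<in> mor \<Lambda>1" "snd q \<in> mor \<Lambda>2"
      and pq: "src \<Lambda>1 (fst p) = rng \<Lambda>1 (fst q)" "src \<Lambda>2 (snd p) = rng \<Lambda>2 (snd q)"
    by (auto simp: prod_kgraph_simps)
  note 1 = p(1) q(1) pq(1) and 2 = p(2) q(2) pq(2)
  show "cmp \<Lambda> p q \<in> mor \<Lambda>" "rng \<Lambda> (cmp \<Lambda> p q) = rng \<Lambda> p" "src \<Lambda> (cmp \<Lambda> p q) = src \<Lambda> q"
    "deg \<Lambda> (cmp \<Lambda> p q) = add_deg (deg \<Lambda> p) (deg \<Lambda> q)"
    using G1.comp_mor[OF 1] G2.comp_mor[OF 2] G1.rng_comp[OF 1] G2.rng_comp[OF 2]
      G1.src_comp[OF 1] G2.src_comp[OF 2] G1.deg_comp[OF 1] G2.deg_comp[OF 2]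
    by (simp_all add: prod_kgraph_simps pair_deg_add)
  fix r assume "r \<in> mor \<Lambda>" and "src \<Lambda> q = rng \<Lambda> r"
  then have r: "fst r \<in> mor \<Lambda>1" "snd r \<in> mor \<Lambda>2"
      and qr: "src \<Lambda>1 (fst q) = rng \<Lambda>1 (fst r)" "src \<Lambda>2 (snd q) = rng \<Lambda>2 (snd r)"
    by (auto simp: prod_kgraph_simps)
  show "cmp \<Lambda> (cmp \<Lambda> p q) r = cmp \<Lambda> p (cmp \<Lambda> q r)"
    using G1.comp_assoc[OF p(1) q(1) r(1) pq(1) qr(1)] G2.comp_assoc[OF p(2) q(2) r(2) pq(2) qr(2)]
    by (simp add: prod_kgraph_simps)
qed

end

lemma finite_k_graph_product:
  assumes "finite_k_graph k1 \<Lambda>1" "finite_k_graph k2 \<Lambda>2"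
  shows "finite_k_graph (k1 + k2) (prod_kgraph k1 \<Lambda>1 \<Lambda>2)"
proof -
  interpret G1: finite_k_graph k1 \<Lambda>1 by fact
  interpret G2: finite_k_graph k2 \<Lambda>2 by fact
  interpret k_graph_pair k1 k2 \<Lambda>1 \<Lambda>2 ..
  interpret k_graph "k1 + k2" \<Lambda>
    by (rule k_graph_product)
  show ?thesis
    by unfold_locales
      (simp add: paths_prod G1.finite_paths G2.finite_paths fst_deg_degrees snd_deg_degrees)
qed

locale semibranching_pair =
  S1: k_graph_semibranching k1 \<Lambda>1 M1 D1 \<tau>1 T1 + S2: k_graph_semibranching k2 \<Lambda>2 M2 D2 \<tau>2 T2 +
  M1: sigma_finite_measure M1 + M2: sigma_finite_measure M2
  for k1 k2 :: nat and \<Lambda>1 :: "'a kgraph" and \<Lambda>2 :: "'b kgraph"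
    and M1 :: "'x measure" and M2 :: "'y measure"
    and D1 :: "'a \<Rightarrow> 'x set" and \<tau>1 :: "'a \<Rightarrow> 'x \<Rightarrow> 'x" and T1 :: "(nat \<Rightarrow> nat) \<Rightarrow> 'x \<Rightarrow> 'x"
    and D2 :: "'b \<Rightarrow> 'y set" and \<tau>2 :: "'b \<Rightarrow> 'y \<Rightarrow> 'y" and T2 :: "(nat \<Rightarrow> nat) \<Rightarrow> 'y \<Rightarrow> 'y"
begin

sublocale k_graph_pair k1 k2 \<Lambda>1 \<Lambda>2 ..

sublocale pair_sigma_finite M1 M2 ..

abbreviation "M \<equiv> M1 \<Otimes>\<^sub>M M2"

abbreviation "prod_map p \<equiv> map_prod (\<tau>1 (fst p)) (\<tau>2 (snd p))"

abbreviation "prod_coding m \<equiv> map_prod (T1 (fst_deg k1 m)) (T2 (snd_deg k1 m))"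

lemma prod_branch:
  assumes "p \<in> mor \<Lambda>"
  shows "nonsingular_branch M (prod_vertex_dom D1 D2 p) (prod_map p) (prod_coding (deg \<Lambda> p))"
proof -
  have p: "fst p \<in> mor \<Lambda>1" "snd p \<in> mor \<Lambda>2"
    using assms by (auto simp: prod_kgraph_simps)
  then have "deg \<Lambda>1 (fst p) = fst_deg k1 (deg \<Lambda> p)" "deg \<Lambda>2 (snd p) = snd_deg k1 (deg \<Lambda> p)"
    using pair_deg_eq_iff[OF S1.deg_degrees[OF p(1)], of "deg \<Lambda>2 (snd p)" "deg \<Lambda> p"]
    by (simp_all add: prod_kgraph_simps)
  then show ?thesis
    using nonsingular_branch_map_prod[OF M1.sigma_finite_measure_axioms M2.sigma_finite_measure_axioms
        S1.branch[OF p(1)] S2.branch[OF p(2)]]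
    by (simp add: prod_vertex_dom_def)
qed

lemma AE_fst: "AE x in M1. P x \<Longrightarrow> AE p in M. P (fst p)"
  and AE_snd: "AE y in M2. Q y \<Longrightarrow> AE p in M. Q (snd p)"
  using AE_pair_fst AE_pair_snd M2.sigma_finite_measure_axioms by blast+

lemma prod_range: "prod_map p ` prod_vertex_dom D1 D2 p = \<tau>1 (fst p) ` D1 (fst p) \<times> \<tau>2 (snd p) ` D2 (snd p)"
  by (auto simp: prod_vertex_dom_def)

lemma prod_semibranching:
  assumes m: "m \<in> degrees (k1 + k2)"
  shows "semibranching M (paths \<Lambda> m) (prod_vertex_dom D1 D2) prod_map"
proof (rule semibranchingI)
  show "sigma_finite_measure M"
    by unfold_locales
  note m1 = fst_deg_degrees[of k1 m] and m2 = snd_deg_degrees[OF m]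
  show "finite (paths \<Lambda> m)"
    using semibranching.finite_index[OF S1.semibranching_paths[OF m1]]
      semibranching.finite_index[OF S2.semibranching_paths[OF m2]] by (simp add: paths_prod)
  show "nonsingular_branch M (prod_vertex_dom D1 D2 p) (prod_map p) (prod_coding m)"
    if "p \<in> paths \<Lambda> m" for p
    using prod_branch[of p] that by (auto simp: paths_def)
  have "AE q in M. \<exists>\<kappa>\<in>paths \<Lambda>1 (fst_deg k1 m). fst q \<in> \<tau>1 \<kappa> ` D1 \<kappa>"
    using S1.AE_ranges_cover[OF m1] by (rule AE_fst)
  moreover have "AE q in M. \<exists>\<kappa>\<in>paths \<Lambda>2 (snd_deg k1 m). snd q \<in> \<tau>2 \<kappa> ` D2 \<kappa>"
    using S2.AE_ranges_cover[OF m2] by (rule AE_snd)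
  ultimately show "AE q in M. \<exists>p\<in>paths \<Lambda> m. q \<in> prod_map p ` prod_vertex_dom D1 D2 p"
  proof eventually_elim
    case (elim q)
    then obtain \<kappa> \<nu> where "\<kappa> \<in> paths \<Lambda>1 (fst_deg k1 m)" "fst q \<in> \<tau>1 \<kappa> ` D1 \<kappa>"
        "\<nu> \<in> paths \<Lambda>2 (snd_deg k1 m)" "snd q \<in> \<tau>2 \<nu> ` D2 \<nu>"
      by blast
    then show ?case
      using prod_range[of "(\<kappa>, \<nu>)"] by (intro bexI[of _ "(\<kappa>, \<nu>)"]) (simp_all add: paths_prod mem_Times_iff)
  qed
  fix p p' assume p: "p \<in> paths \<Lambda> m" "p' \<in> paths \<Lambda> m" "p \<noteq> p'"
  then consider "fst p \<noteq> fst p'" | "snd p \<noteq> snd p'"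
    by (auto simp: prod_eq_iff)
  then show "AE q in M. \<not> (q \<in> prod_map p ` prod_vertex_dom D1 D2 p \<and>
      q \<in> prod_map p' ` prod_vertex_dom D1 D2 p')"
  proof cases
    case 1
    then have "AE x in M1. \<not> (x \<in> \<tau>1 (fst p) ` D1 (fst p) \<and> x \<in> \<tau>1 (fst p') ` D1 (fst p'))"
      using p by (intro S1.AE_ranges_disjoint) (auto simp: paths_prod)
    from AE_fst[OF this] show ?thesis
      unfolding prod_range by eventually_elim (auto simp: mem_Times_iff)
  next
    case 2
    then have "AE x in M2. \<not> (x \<in> \<tau>2 (snd p) ` D2 (snd p) \<and> x \<in> \<tau>2 (snd p') ` D2 (snd p'))"
      using p by (intro S2.AE_ranges_disjoint) (auto simp: paths_prod)
    from AE_snd[OF this] show ?thesis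
      unfolding prod_range by eventually_elim (auto simp: mem_Times_iff)
  qed
qed

lemma prod_system:
  "Lambda_semibranching (k1 + k2) \<Lambda> M (prod_vertex_dom D1 D2) prod_map prod_coding"
proof (rule Lambda_semibranching.intro)
  show "semibranching M (paths \<Lambda> m) (prod_vertex_dom D1 D2) prod_map" if "m \<in> degrees (k1 + k2)" for m
    using that by (rule prod_semibranching)
  show "coding_map M (paths \<Lambda> m) (prod_vertex_dom D1 D2) prod_map (prod_coding m)"
    if m: "m \<in> degrees (k1 + k2)" for m
  proof -
    have "T1 (fst_deg k1 m) \<in> measurable M1 M1" "T2 (snd_deg k1 m) \<in> measurable M2 M2"
      using S1.coding[OF fst_deg_degrees] S2.coding[OF snd_deg_degrees[OF m]]
      by (auto simp: coding_map_def)
    then have "prod_coding m \<in> measurable M M"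
      unfolding map_prod_def by measurable
    then show ?thesis
      unfolding coding_map_def using nonsingular_branch.left_inverse[OF prod_branch]
      by (auto simp: paths_def)
  qed
  show "prod_map v x = x" if "v \<in> verts \<Lambda>" "x \<in> prod_vertex_dom D1 D2 v" for v x
    using that by (auto simp: verts_prod prod_vertex_dom_def S1.vertex_map S2.vertex_map)
  show "0 < emeasure M (prod_vertex_dom D1 D2 v)" if "v \<in> verts \<Lambda>" for v
  proof -
    have v: "fst v \<in> verts \<Lambda>1" "snd v \<in> verts \<Lambda>2"
      using that by (auto simp: verts_prod)
    have "D1 (fst v) \<in> sets M1" "D2 (snd v) \<in> sets M2"
      using S1.branch[OF S1.verts_mor[OF v(1)]] S2.branch[OF S2.verts_mor[OF v(2)]]
      by (auto dest: nonsingular_branch.dom_sets)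
    then show ?thesis
      using S1.vertex_pos[OF v(1)] S2.vertex_pos[OF v(2)]
      by (simp add: prod_vertex_dom_def M2.emeasure_pair_measure_Times ennreal_zero_less_mult_iff)
  qed
  fix p q assume "p \<in> mor \<Lambda>" "q \<in> mor \<Lambda>" "src \<Lambda> p = rng \<Lambda> q"
  then have 1: "fst p \<in> mor \<Lambda>1" "fst q \<in> mor \<Lambda>1" "src \<Lambda>1 (fst p) = rng \<Lambda>1 (fst q)"
    and 2: "snd p \<in> mor \<Lambda>2" "snd q \<in> mor \<Lambda>2" "src \<Lambda>2 (snd p) = rng \<Lambda>2 (snd q)"
    by (auto simp: prod_kgraph_simps)
  show "ae_subset M (prod_map q ` prod_vertex_dom D1 D2 q) (prod_vertex_dom D1 D2 p)"
    using AE_fst[OF S1.range_subset[OF 1, unfolded ae_subset_def]]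
      AE_snd[OF S2.range_subset[OF 2, unfolded ae_subset_def]]
    unfolding ae_subset_def prod_range
    by eventually_elim (auto simp: prod_vertex_dom_def)
  show "ae_eq_map M (comp_dom (prod_vertex_dom D1 D2 p) (prod_vertex_dom D1 D2 q) (prod_map q))
      (prod_map p \<circ> prod_map q) (prod_vertex_dom D1 D2 (cmp \<Lambda> p q)) (prod_map (cmp \<Lambda> p q))"
    using AE_fst[OF S1.map_comp[OF 1, unfolded ae_eq_map_iff]]
      AE_snd[OF S2.map_comp[OF 2, unfolded ae_eq_map_iff]]
    unfolding ae_eq_map_iff
    by eventually_elim (auto simp: prod_vertex_dom_def prod_kgraph_simps comp_dom_def)
next
  show "prod_coding m (prod_coding n x) = prod_coding (add_deg m n) x"
    if "m \<in> degrees (k1 + k2)" "n \<in> degrees (k1 + k2)" "x \<in> space M" for m n x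
    using that by (auto simp: space_pair_measure fst_deg_add snd_deg_add S1.coding_comp S2.coding_comp
        fst_deg_degrees snd_deg_degrees)
qed

text \<open>An edge has a vertex as one of its components, and the maps of vertices are the identity, so the
  edge map is literally a restriction of the product map. The restriction loses only a null set,
  because the domain of the other component is almost everywhere that of its source.\<close>

lemma prod_edge_restricts:
  assumes f: "f \<in> edges \<Lambda>"
  shows "prod_edge_dom \<Lambda>1 \<Lambda>2 D1 D2 f \<subseteq> prod_vertex_dom D1 D2 f"
    and "p \<in> prod_edge_dom \<Lambda>1 \<Lambda>2 D1 D2 f \<Longrightarrow> prod_edge_map \<Lambda>2 \<tau>1 \<tau>2 f p = prod_map f p"
    and "prod_edge_dom \<Lambda>1 \<Lambda>2 D1 D2 f \<in> sets M"
    and "ae_eq_set M (prod_edge_dom \<Lambda>1 \<Lambda>2 D1 D2 f) (prod_vertex_dom D1 D2 f)"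
proof -
  let ?De = "prod_edge_dom \<Lambda>1 \<Lambda>2 D1 D2 f" and ?D = "prod_vertex_dom D1 D2 f"
  obtain i where "f \<in> paths \<Lambda> (unit_deg i)"
    using f by (auto simp: edges_def)
  then have mor: "fst f \<in> mor \<Lambda>1" "snd f \<in> mor \<Lambda>2"
    and cases: "fst f \<in> verts \<Lambda>1 \<or> snd f \<in> verts \<Lambda>2"
    unfolding paths_prod by (auto simp: paths_def verts_def fst_deg_unit snd_deg_unit split: if_splits)
  have sets1: "D1 \<kappa> \<in> sets M1" if "\<kappa> \<in> mor \<Lambda>1" for \<kappa>
    using S1.branch[OF that] by (rule nonsingular_branch.dom_sets)
  have sets2: "D2 \<kappa> \<in> sets M2" if "\<kappa> \<in> mor \<Lambda>2" for \<kappa>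
    using S2.branch[OF that] by (rule nonsingular_branch.dom_sets)
  have "?De \<subseteq> ?D \<and> (\<forall>p\<in>?De. prod_edge_map \<Lambda>2 \<tau>1 \<tau>2 f p = prod_map f p) \<and> ?De \<in> sets M \<and> ae_eq_set M ?De ?D"
  proof (cases "snd f \<in> verts \<Lambda>2")
    case True
    have De: "?De = (D1 (src \<Lambda>1 (fst f)) \<inter> D1 (fst f)) \<times> D2 (snd f)"
      using S2.verts_deg[OF True] by (auto simp: prod_edge_dom_def prod_vertex_dom_def)
    have "ae_eq_set M ?De ?D"
      using AE_fst[OF S1.dom_eq_dom_src[OF mor(1), unfolded ae_eq_set_def]]
      unfolding ae_eq_set_def De by eventually_elim (auto simp: prod_vertex_dom_def)
    moreover have "?De \<in> sets M"
      unfolding De using mor S1.src_mor sets1 sets2 by auto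
    moreover have "prod_edge_map \<Lambda>2 \<tau>1 \<tau>2 f p = prod_map f p" if "p \<in> ?De" for p
      using that S2.verts_deg[OF True] S2.vertex_map[OF True] by (auto simp: De prod_edge_map_def)
    ultimately show ?thesis
      by (auto simp: De prod_vertex_dom_def)
  next
    case False
    then have w: "fst f \<in> verts \<Lambda>1" and nz: "deg \<Lambda>2 (snd f) \<noteq> zero_deg"
      using cases mor(2) by (auto simp: verts_def paths_def)
    have De: "?De = D1 (fst f) \<times> (D2 (src \<Lambda>2 (snd f)) \<inter> D2 (snd f))"
      using nz by (auto simp: prod_edge_dom_def prod_vertex_dom_def)
    have "ae_eq_set M ?De ?D"
      using AE_snd[OF S2.dom_eq_dom_src[OF mor(2), unfolded ae_eq_set_def]]
      unfolding ae_eq_set_def De by eventually_elim (auto simp: prod_vertex_dom_def)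
    moreover have "?De \<in> sets M"
      unfolding De using mor S2.src_mor sets1 sets2 by auto
    moreover have "prod_edge_map \<Lambda>2 \<tau>1 \<tau>2 f p = prod_map f p" if "p \<in> ?De" for p
      using that nz S1.vertex_map[OF w] by (auto simp: De prod_edge_map_def)
    ultimately show ?thesis
      by (auto simp: De prod_vertex_dom_def)
  qed
  then show "?De \<subseteq> ?D" "?De \<in> sets M" "ae_eq_set M ?De ?D"
    and "p \<in> ?De \<Longrightarrow> prod_edge_map \<Lambda>2 \<tau>1 \<tau>2 f p = prod_map f p"
    by auto
qed

lemma prod_edge_coding_left_inverse:
  assumes f: "f \<in> paths \<Lambda> (unit_deg i)" and p: "p \<in> prod_edge_dom \<Lambda>1 \<Lambda>2 D1 D2 f"
  shows "prod_edge_coding k1 T1 T2 i (prod_edge_map \<Lambda>2 \<tau>1 \<tau>2 f p) = p"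
proof (cases "i < k1")
  case True
  then have "fst f \<in> paths \<Lambda>1 (unit_deg i)" and z: "deg \<Lambda>2 (snd f) = zero_deg"
    using f unfolding paths_prod by (auto simp: fst_deg_unit snd_deg_unit paths_def)
  then have "T1 (unit_deg i) (\<tau>1 (fst f) x) = x" if "x \<in> D1 (fst f)" for x
    using nonsingular_branch.left_inverse[OF S1.branch that] by (auto simp: paths_def)
  then show ?thesis
    using p z True by (auto simp: prod_edge_coding_def prod_edge_map_def prod_edge_dom_def case_prod_unfold)
next
  case False
  then have e: "snd f \<in> paths \<Lambda>2 (unit_deg (i - k1))"
    using f by (auto simp: paths_prod snd_deg_unit)
  then have "deg \<Lambda>2 (snd f) \<noteq> zero_deg"
    by (auto simp: paths_def unit_deg_def zero_deg_def fun_eq_iff)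
  moreover have "T2 (unit_deg (i - k1)) (\<tau>2 (snd f) x) = x" if "x \<in> D2 (snd f)" for x
    using nonsingular_branch.left_inverse[OF S2.branch that] e by (auto simp: paths_def)
  ultimately show ?thesis
    using p False by (auto simp: prod_edge_coding_def prod_edge_map_def prod_edge_dom_def case_prod_unfold)
qed

lemma unit_coding_measurable:
  "i < k1 \<Longrightarrow> T1 (unit_deg i) \<in> measurable M1 M1"
  "i < k2 \<Longrightarrow> T2 (unit_deg i) \<in> measurable M2 M2"
  using S1.coding[of "unit_deg i"] S2.coding[of "unit_deg i"]
  by (auto simp: coding_map_def unit_deg_degrees)

lemma prod_edge_coding_measurable:
  assumes "i < k1 + k2"
  shows "prod_edge_coding k1 T1 T2 i \<in> measurable M M"
proof (cases "i < k1")
  case True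
  note [measurable] = unit_coding_measurable(1)[OF True]
  show ?thesis
    using True by (simp add: prod_edge_coding_def)
next
  case False
  then have "i - k1 < k2"
    using assms by simp
  note [measurable] = unit_coding_measurable(2)[OF this]
  show ?thesis
    using False by (simp add: prod_edge_coding_def)
qed

lemma prod_edge_coding_commute:
  assumes "i < k1 + k2" "j < k1 + k2" "p \<in> space M"
  shows "prod_edge_coding k1 T1 T2 i (prod_edge_coding k1 T1 T2 j p) =
         prod_edge_coding k1 T1 T2 j (prod_edge_coding k1 T1 T2 i p)"
proof -
  have "T1 (unit_deg i) (T1 (unit_deg j) x) = T1 (unit_deg j) (T1 (unit_deg i) x)"
    if "i < k1" "j < k1" "x \<in> space M1" for i j x
    using that by (simp add: S1.coding_comp unit_deg_degrees add_deg_commute)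
  moreover have "T2 (unit_deg i) (T2 (unit_deg j) x) = T2 (unit_deg j) (T2 (unit_deg i) x)"
    if "i < k2" "j < k2" "x \<in> space M2" for i j x
    using that by (simp add: S2.coding_comp unit_deg_degrees add_deg_commute)
  ultimately show ?thesis
    using assms by (auto simp: prod_edge_coding_def space_pair_measure)
qed

lemma prod_edge_presentation:
  "edge_presentation (k1 + k2) \<Lambda> M (prod_vertex_dom D1 D2) prod_map prod_coding
     (prod_edge_dom \<Lambda>1 \<Lambda>2 D1 D2) (prod_edge_map \<Lambda>2 \<tau>1 \<tau>2) (prod_edge_coding k1 T1 T2)"
proof -
  interpret k_graph_semibranching "k1 + k2" \<Lambda> M "prod_vertex_dom D1 D2" prod_map prod_coding
    using k_graph_product prod_system by (rule k_graph_semibranching.intro)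
  show ?thesis
  proof (intro edge_presentation.intro edge_presentation_axioms.intro)
    show "k_graph_semibranching (k1 + k2) \<Lambda> M (prod_vertex_dom D1 D2) prod_map prod_coding"
      "sigma_finite_measure M"
      by unfold_locales
    show "nonsingular_branch M (prod_edge_dom \<Lambda>1 \<Lambda>2 D1 D2 f) (prod_edge_map \<Lambda>2 \<tau>1 \<tau>2 f)
        (prod_edge_coding k1 T1 T2 i)"
      if i: "i < k1 + k2" and f: "f \<in> paths \<Lambda> (unit_deg i)" for i f
    proof (rule nonsingular_branch.restrict)
      show "nonsingular_branch M (prod_vertex_dom D1 D2 f) (prod_map f) (prod_coding (deg \<Lambda> f))"
        using f by (intro prod_branch) (rule pathsD)
      have e: "f \<in> edges \<Lambda>"
        using f by (auto simp: edges_def)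
      show "prod_edge_dom \<Lambda>1 \<Lambda>2 D1 D2 f \<in> sets M"
        "prod_edge_dom \<Lambda>1 \<Lambda>2 D1 D2 f \<subseteq> prod_vertex_dom D1 D2 f"
        using prod_edge_restricts[OF e] by auto
      show "prod_edge_map \<Lambda>2 \<tau>1 \<tau>2 f p = prod_map f p" if "p \<in> prod_edge_dom \<Lambda>1 \<Lambda>2 D1 D2 f" for p
        using e that by (rule prod_edge_restricts)
      show "prod_edge_coding k1 T1 T2 i \<in> measurable M M"
        using i by (rule prod_edge_coding_measurable)
      show "prod_edge_coding k1 T1 T2 i (prod_edge_map \<Lambda>2 \<tau>1 \<tau>2 f p) = p"
        if "p \<in> prod_edge_dom \<Lambda>1 \<Lambda>2 D1 D2 f" for p
        using f that by (rule prod_edge_coding_left_inverse)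
    qed
    show "ae_eq_map M (prod_edge_dom \<Lambda>1 \<Lambda>2 D1 D2 f) (prod_edge_map \<Lambda>2 \<tau>1 \<tau>2 f)
        (prod_vertex_dom D1 D2 f) (prod_map f)" if "f \<in> edges \<Lambda>" for f
      using prod_edge_restricts[OF that] by (auto simp: ae_eq_map_def)
  qed (use prod_edge_coding_measurable prod_edge_coding_commute in auto)
qed

end

theorem proposition3p4:
  fixes k1 k2 :: nat
    and \<Lambda>1 :: "'a kgraph" and \<Lambda>2 :: "'b kgraph"
    and M1 :: "'x measure" and M2 :: "'y measure"
    and D1 :: "'a \<Rightarrow> 'x set" and \<tau>1 :: "'a \<Rightarrow> 'x \<Rightarrow> 'x" and T1 :: "(nat \<Rightarrow> nat) \<Rightarrow> 'x \<Rightarrow> 'x"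
    and D2 :: "'b \<Rightarrow> 'y set" and \<tau>2 :: "'b \<Rightarrow> 'y \<Rightarrow> 'y" and T2 :: "(nat \<Rightarrow> nat) \<Rightarrow> 'y \<Rightarrow> 'y"
  assumes "sigma_finite_measure M1" and "sigma_finite_measure M2"
    and "finite_k_graph k1 \<Lambda>1" and "finite_k_graph k2 \<Lambda>2"
    and "Lambda_semibranching k1 \<Lambda>1 M1 D1 \<tau>1 T1"
    and "Lambda_semibranching k2 \<Lambda>2 M2 D2 \<tau>2 T2"
  shows "let k = k1 + k2;
             \<Lambda> = prod_kgraph k1 \<Lambda>1 \<Lambda>2;
             M = M1 \<Otimes>\<^sub>M M2;
             Dv = prod_vertex_dom D1 D2;
             De = prod_edge_dom \<Lambda>1 \<Lambda>2 D1 D2;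
             \<tau> = prod_edge_map \<Lambda>2 \<tau>1 \<tau>2;
             Te = prod_edge_coding k1 T1 T2
         in finite_k_graph k \<Lambda> \<and>
            edge_conditions k \<Lambda> M Dv De \<tau> Te \<and>
            (\<forall>\<kappa>\<in>mor \<Lambda>. \<exists>fs. edge_fact \<Lambda> fs \<kappa>) \<and>
            (\<forall>F. (\<forall>\<kappa>\<in>mor \<Lambda>. edge_fact \<Lambda> (F \<kappa>) \<kappa>) \<longrightarrow>
               Lambda_semibranching k \<Lambda> M
                 (\<lambda>\<kappa>. path_dom (Dv (src \<Lambda> \<kappa>)) De \<tau> (F \<kappa>))
                 (\<lambda>\<kappa>. path_map \<tau> (F \<kappa>))
                 (coding_power k Te))"
proof -
  interpret M1: sigma_finite_measure M1 by fact
  interpret M2: sigma_finite_measure M2 by fact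
  interpret G1: finite_k_graph k1 \<Lambda>1 by fact
  interpret G2: finite_k_graph k2 \<Lambda>2 by fact
  interpret L1: Lambda_semibranching k1 \<Lambda>1 M1 D1 \<tau>1 T1 by fact
  interpret L2: Lambda_semibranching k2 \<Lambda>2 M2 D2 \<tau>2 T2 by fact
  interpret semibranching_pair k1 k2 \<Lambda>1 \<Lambda>2 M1 M2 D1 \<tau>1 T1 D2 \<tau>2 T2 ..
  interpret edge_presentation "k1 + k2" \<Lambda> M "prod_vertex_dom D1 D2" prod_map prod_coding
    "prod_edge_dom \<Lambda>1 \<Lambda>2 D1 D2" "prod_edge_map \<Lambda>2 \<tau>1 \<tau>2" "prod_edge_coding k1 T1 T2"
    by (rule prod_edge_presentation)
  show ?thesis
    unfolding Let_def
    using finite_k_graph_product[OF assms(3,4)] satisfies_edge_conditions edge_fact_exists path_system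
    by blast
qed

end
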